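(* Let $n\ge 3$ and $m\ge 4$ be integers. For integers $0\le l\le n$ put $\alpha_l = 2\left(1-\cos\frac{l\pi}{n}\right)$, and put $\beta^{\pm}_{m,1}=\frac12\left[m+1\pm\sqrt{(m+1)^2-4}\right]$. Assume $\beta^{-}_{m,1}\notin\{\alpha_l : 0\le l< n\}$. For a modification $\overline\delta=(\delta_0,\dots,\delta_{m-1})\neq 0$ with all $\delta_i\ge 0$, put $\delta=\delta_0+\delta_1+\cdots+\delta_{m-1}$; let $L_G$ be the Laplacian of the unmodified graph of Model II and $L_{G_p}=L_G(\overline\delta)$ the Laplacian of the modified graph of Model II (both written out explicitly in the context). Then the following hold. (i) (Local modification) If $\overline\delta\ne 0$ is sufficiently small (i.e. there is $\varepsilon>0$ such that the following holds for all modifications with $0<\delta<\varepsilon$), then all the eigenvalues of $L_{G_p}$ are real, and (a) if $\alpha_1<\beta^{-}_{m,1}$, then $\lambda_2(L_{G_p})<\lambda_2(L_G)$; (b) if $\beta^{-}_{m,1}<\alpha_1$, then $\lambda_2(L_{G_p})>\lambda_2(L_G)$. (ii) (Global modification) Let $\overline\delta\neq 0$ be an arbitrary modification. (a) If $\alpha_2<\beta^{-}_{m,1}$, then $\mathrm{Re}\left(\lambda_2(L_{G_p})\right)<\lambda_2(L_G)$. (b) If $\delta<\delta_0\,\beta^{+}_{m,1}$, then all the eigenvalues of $L_{G_p}$ are real; moreover, if $\alpha_1<\beta^{-}_{m,1}$ then $\lambda_2(L_{G_p})<\lambda_2(L_G)$, and if $\beta^{-}_{m,1}<\alpha_1$ then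 $\lambda_2(L_{G_p})>\lambda_2(L_G)$.
   Context: Laplacian convention: for a weighted digraph with adjacency matrix $A=(A_{ij})$, $A_{ij}\ge 0$ being the weight of the edge from node $j$ to node $i$, the Laplacian is $L=D-A$, where $D$ is diagonal with $D_{ii}=\sum_j A_{ij}$. Model II: the unmodified graph $G$ consists of an undirected cycle $C_n$ with nodes $0,\dots,n-1$, an undirected star $S_m$ with $m$ nodes $0,\dots,m-1$ (node $0$ is the hub, the others are leaves), all these edges having weight $1$, and one directed edge of weight $1$ from node $0$ of the cycle to the hub of the star. The modified graph $G_p$ is obtained by adding, for each $0\le i\le m-1$, a directed edge of weight $\delta_i\ge0$ from node $i$ of the star to node $0$ of the cycle. Explicitly, ordering the cycle nodes first and then the star nodes, these are the $(n+m)\times(n+m)$ real matrices $$L_G=\begin{pmatrix} L_{C_n} & 0\\ -C & L_{S_m}+D_C\end{pmatrix},\qquad L_{G_p}=\begin{pmatrix} L_{C_n}+D_\Delta & -\Delta\\ -C & L_{S_m}+D_C\end{pmatrix},$$ where $L_{C_n}$ is the Laplacian of the cycle ($2$ on the diagonal, $-1$ at cyclically adjacent pairs), $L_{S_m}=\begin{pmatrix} m-1 & -\mathbf 1_{m-1}^{\top}\\ -\mathbf 1_{m-1} & I_{m-1}\end{pmatrix}$ (with $\mathbf 1_{k}$ the all-ones vector in $\mathbb R^k$), $C$ is the $m\times n$ matrix whose only nonzero entry is its top-left entry, equal to $1$, $D_C$ is the $m\times m$ matrix whose only nonzero entry is its top-left entry, equal to $1$, $\Delta$ is the $n\times m$ matrix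 whose first row is $(\delta_0,\delta_1,\dots,\delta_{m-1})$ and whose other rows are zero, and $D_\Delta$ is the $n\times n$ matrix whose only nonzero entry is its top-left entry, equal to $\delta$. Spectral gap: for each of these Laplacians $0$ is a simple eigenvalue and all other eigenvalues have positive real part. Listing the eigenvalues with algebraic multiplicity as $0=\lambda_1<\mathrm{Re}(\lambda_2)\le \mathrm{Re}(\lambda_3)\le\cdots$, $\lambda_2(L)$ denotes the second one in this ordering by real parts. All eigenvalues of $L_G$ are real. *)

theory Defs
  imports "Jordan_Normal_Form.Char_Poly"
begin

text \<open>The parameters \<open>n\<close> and \<open>m\<close> are the sizes of the cycle and of the star; the weights
  \<open>d\<close> form a vector of dimension \<open>m\<close>. The blocks below are meant for \<open>n \<ge> 3\<close>
  (for smaller \<open>n\<close> cyclic adjacency degenerates).\<close>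

definition cycle_laplacian :: "nat \<Rightarrow> real mat" where
  "cycle_laplacian n = mat n n (\<lambda>(i, j).
     if i = j then 2
     else if j = (i + 1) mod n \<or> i = (j + 1) mod n then -1
     else 0)"

definition star_laplacian :: "nat \<Rightarrow> real mat" where
  "star_laplacian m = mat m m (\<lambda>(i, j).
     if i = 0 \<and> j = 0 then real m - 1
     else if i = 0 \<or> j = 0 then -1
     else if i = j then 1
     else 0)"

definition corner_mat :: "nat \<Rightarrow> nat \<Rightarrow> real \<Rightarrow> real mat" where
  "corner_mat r c x = mat r c (\<lambda>(i, j). if i = 0 \<and> j = 0 then x else 0)"

definition first_row_mat :: "nat \<Rightarrow> real vec \<Rightarrow> real mat" where
  "first_row_mat r d = mat r (dim_vec d) (\<lambda>(i, j). if i = 0 then d $ j else 0)"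

definition total_weight :: "real vec \<Rightarrow> real" where
  "total_weight d = (\<Sum>i<dim_vec d. d $ i)"

definition L_G :: "nat \<Rightarrow> nat \<Rightarrow> real mat" where
  "L_G n m = four_block_mat
     (cycle_laplacian n)     (0\<^sub>m n m)
     (- corner_mat m n 1)    (star_laplacian m + corner_mat m m 1)"

definition L_Gp :: "nat \<Rightarrow> nat \<Rightarrow> real vec \<Rightarrow> real mat" where
  "L_Gp n m d = four_block_mat
     (cycle_laplacian n + corner_mat n n (total_weight d))    (- first_row_mat n d)
     (- corner_mat m n 1)                                     (star_laplacian m + corner_mat m m 1)"

definition modification :: "nat \<Rightarrow> real vec \<Rightarrow> bool" where
  "modification m d \<longleftrightarrow> d \<in> carrier_vec m \<and> d \<noteq> 0\<^sub>v m \<and> (\<forall>i<m. 0 \<le> d $ i)"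

definition alpha :: "nat \<Rightarrow> nat \<Rightarrow> real" where
  "alpha n l = 2 * (1 - cos (real l * pi / real n))"

definition beta_minus :: "nat \<Rightarrow> real" where
  "beta_minus m = (1/2) * (real m + 1 - sqrt ((real m + 1)^2 - 4))"

definition beta_plus :: "nat \<Rightarrow> real" where
  "beta_plus m = (1/2) * (real m + 1 + sqrt ((real m + 1)^2 - 4))"

abbreviation complex_mat :: "real mat \<Rightarrow> complex mat" where
  "complex_mat L \<equiv> map_mat complex_of_real L"

definition all_eigenvalues_real :: "real mat \<Rightarrow> bool" where
  "all_eigenvalues_real L \<longleftrightarrow> (\<forall>z. eigenvalue (complex_mat L) z \<longrightarrow> z \<in> \<real>)"

definition eigenvalue_listing :: "real mat \<Rightarrow> complex list \<Rightarrow> bool" where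
  "eigenvalue_listing L zs \<longleftrightarrow>
     char_poly (complex_mat L) = (\<Prod>z\<leftarrow>zs. [:- z, 1:]) \<and> sorted (map Re zs)"

text \<open>List indices start at 0, so index 1 is the second eigenvalue. Ties between eigenvalues with
  equal real part leave the value itself undetermined, but not its real part:
  see \<open>Re_lambda2_eq\<close> below.\<close>

definition lambda2 :: "real mat \<Rightarrow> complex" where
  "lambda2 L = (SOME zs. eigenvalue_listing L zs) ! 1"

lemma eigenvalue_listing_exists:
  assumes "L \<in> carrier_mat k k"
  shows "\<exists>zs. eigenvalue_listing L zs"
proof -
  have "complex_mat L \<in> carrier_mat k k" using assms by simp
  from char_poly_factorized[OF this] obtain zs
    where zs: "char_poly (complex_mat L) = (\<Prod>z\<leftarrow>zs. [:- z, 1:])" by blast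
  have "(\<Prod>z\<leftarrow>sort_key Re zs. [:- z, 1:]) = (\<Prod>z\<leftarrow>zs. [:- z, 1:])"
  proof -
    have "mset (map (\<lambda>z. [:- z, 1:]) (sort_key Re zs)) = mset (map (\<lambda>z. [:- z, 1:]) zs)"
      by simp
    then show ?thesis by (metis prod_mset_prod_list)
  qed
  then have "eigenvalue_listing L (sort_key Re zs)"
    unfolding eigenvalue_listing_def zs by simp
  then show ?thesis by blast
qed

lemma eigenvalue_listing_Re_unique:
  assumes "eigenvalue_listing L zs" and "eigenvalue_listing L ws"
  shows "map Re zs = map Re ws"
proof -
  have eq: "(\<Prod>z\<leftarrow>zs. [:- z, 1:]) = (\<Prod>z\<leftarrow>ws. [:- z, 1:])"
    using assms unfolding eigenvalue_listing_def by simp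
  have "proots (\<Prod>z\<leftarrow>xs. [:- z, 1:]) = mset xs" for xs :: "complex list"
  proof -
    have "0 \<notin> set (map (\<lambda>z. [:- z, 1:]) xs)" by auto
    from proots_prod_list[OF this]
    have "proots (\<Prod>z\<leftarrow>xs. [:- z, 1:]) = (\<Sum>z\<leftarrow>xs. proots [:- z, 1:])"
      by (simp add: o_def)
    also have "\<dots> = (\<Sum>z\<leftarrow>xs. {#z#})" by simp
    also have "\<dots> = mset xs" by (induction xs) simp_all
    finally show ?thesis .
  qed
  then have "mset zs = mset ws" using eq by metis
  then have perm: "mset (map Re zs) = mset (map Re ws)" by simp
  have "sorted (map Re zs)" "sorted (map Re ws)"
    using assms unfolding eigenvalue_listing_def by blast+
  with properties_for_sort[OF perm] properties_for_sort[of "map Re ws" "map Re ws"]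
  show ?thesis by simp
qed

lemma Re_lambda2_eq:
  assumes "eigenvalue_listing L zs" and "1 < length zs"
  shows "Re (lambda2 L) = Re (zs ! 1)"
proof -
  let ?ws = "SOME zs. eigenvalue_listing L zs"
  have "eigenvalue_listing L ?ws" using assms(1) by (rule someI)
  from eigenvalue_listing_Re_unique[OF this assms(1)] have eq: "map Re ?ws = map Re zs" .
  then have "1 < length ?ws" using assms(2) by (metis length_map)
  then show ?thesis using assms(2) arg_cong[OF eq, of "\<lambda>xs. xs ! 1"]
    by (simp add: lambda2_def)
qed

end

theory Submission
  imports Defs
begin

text \<open>No characteristic polynomial is computed; everything is read off the eigenvector equations
  \<open>L w = z w\<close> with \<open>w = (u, v)\<close>. Solving the star for \<open>z \<noteq> 1\<close> leaves the cycle equation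
  \<open>(L\<^sub>C - z) u = g(z) u\<^sub>0 e\<^sub>0\<close> with the response
  \<open>g(z) = (\<delta> - \<delta>\<^sub>0 z) / ((z - \<beta>\<^sup>-) (z - \<beta>\<^sup>+)) - \<delta>\<close>.

  Reality: pairing with \<open>u\<close> and taking imaginary parts gives
  \<open>|u|\<^sup>2 = |u\<^sub>0|\<^sup>2 (A / |z - \<beta>\<^sup>-|\<^sup>2 + B / |z - \<beta>\<^sup>+|\<^sup>2)\<close> for nonreal \<open>z\<close>, where \<open>A \<le> 0\<close> always and
  \<open>B < 0\<close> when \<open>\<delta> < \<delta>\<^sub>0 \<beta>\<^sup>+\<close>, a contradiction. If \<open>B > 0\<close> but \<open>\<delta>\<close> is small, the real part contradicts
  the closeness of \<open>z\<close> to \<open>\<beta>\<^sup>+\<close> that the imaginary part enforces, since \<open>\<beta>\<^sup>+ > 4 \<ge> \<parallel>L\<^sub>C\<parallel>\<close>.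

  Gap: with \<open>z = 2 - 2 cos \<theta>\<close> and \<open>u\<^sub>i = cos ((n/2 - i) \<theta>)\<close> the eigenvalue equation becomes the vanishing of
  \<open>2 (z - \<beta>\<^sup>-) (z - \<beta>\<^sup>+) sin (n\<theta>/2) sin \<theta> + z (\<delta> (m + 1 - z) - \<delta>\<^sub>0) cos (n\<theta>/2)\<close>. If \<open>\<alpha>\<^sub>1 < \<beta>\<^sup>-\<close>, it changes sign between
  \<open>\<alpha>\<^sub>1\<close> and \<open>min \<alpha>\<^sub>2 \<beta>\<^sup>-\<close>; if \<open>\<beta>\<^sup>- < \<alpha>\<^sub>1\<close>, both terms are nonnegative and the second is positive on \<open>(0, \<beta>\<^sup>-]\<close>.
  On the other side, every nonzero eigenvalue of the unmodified Laplacian is at least \<open>min \<alpha>\<^sub>2 \<beta>\<^sup>-\<close>, and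
  \<open>\<beta>\<^sup>-\<close> is one of them.\<close>

section \<open>A simple zero eigenvalue\<close>

text \<open>Conjugating by a matrix whose first column is the all-ones vector clears the first column of \<open>A\<close>;
  a kernel vector of the remaining minor would be a vector \<open>w\<close> as in the last hypothesis.\<close>

lemma char_poly_zero_row_sums:
  fixes A :: "'a :: field mat"
  assumes A: "A \<in> carrier_mat k k" and k: "0 < k"
    and ones: "A *\<^sub>v vec k (\<lambda>_. 1) = 0\<^sub>v k"
    and ker: "\<And>w c. w \<in> carrier_vec k \<Longrightarrow> w $ 0 = 0 \<Longrightarrow> A *\<^sub>v w = vec k (\<lambda>_. c) \<Longrightarrow> w = 0\<^sub>v k"
  shows "\<exists>p. char_poly A = [:0, 1:] * p \<and> poly p 0 \<noteq> 0"
proof -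
  \<comment> \<open>\<open>P\<close> is the identity with its first column replaced by ones, so it
    adds entry 0 of a vector to all others; \<open>Q\<close> subtracts it again.\<close>
  define P :: "'a mat" where "P = mat k k (\<lambda>(i, j). if j = 0 \<or> i = j then 1 else 0)"
  define Q :: "'a mat" where "Q = mat k k (\<lambda>(i, j). if i = j then 1 else if j = 0 then -1 else 0)"
  have PQ: "P \<in> carrier_mat k k" "Q \<in> carrier_mat k k" by (auto simp: P_def Q_def)
  have P_mult: "(P *\<^sub>v w) $ i = (if i = 0 then w $ 0 else w $ 0 + w $ i)"
    if "w \<in> carrier_vec k" "i < k" for w i
  proof -
    have "(P *\<^sub>v w) $ i = (\<Sum>j<k. (if j = 0 \<or> i = j then 1 else 0) * w $ j)"
      using that by (simp add: P_def scalar_prod_def lessThan_atLeast0)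
    also have "\<dots> = (\<Sum>j<k. (if j = 0 then w $ 0 else 0) + (if j = i then (if i = 0 then 0 else w $ i) else 0))"
      by (rule sum.cong) auto
    finally show ?thesis using that k by (simp add: sum.distrib)
  qed
  have Q_mult: "(Q *\<^sub>v w) $ i = (if i = 0 then w $ 0 else w $ i - w $ 0)"
    if "w \<in> carrier_vec k" "i < k" for w i
  proof -
    have "(Q *\<^sub>v w) $ i = (\<Sum>j<k. (if i = j then 1 else if j = 0 then -1 else 0) * w $ j)"
      using that by (simp add: Q_def scalar_prod_def lessThan_atLeast0)
    also have "\<dots> = (\<Sum>j<k. (if j = i then w $ i else 0) + (if j = 0 then (if i = 0 then 0 else - w $ 0) else 0))"
      by (rule sum.cong) auto
    finally show ?thesis using that k by (simp add: sum.distrib)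
  qed
  have QPw: "Q *\<^sub>v (P *\<^sub>v w) = w" and PQw: "P *\<^sub>v (Q *\<^sub>v w) = w" if w: "w \<in> carrier_vec k" for w
  proof -
    have c: "P *\<^sub>v w \<in> carrier_vec k" "Q *\<^sub>v w \<in> carrier_vec k"
      using mult_mat_vec_carrier[OF PQ(1) w] mult_mat_vec_carrier[OF PQ(2) w] by auto
    show "Q *\<^sub>v (P *\<^sub>v w) = w"
    proof (rule eq_vecI)
      fix i assume "i < dim_vec w"
      then show "(Q *\<^sub>v (P *\<^sub>v w)) $ i = w $ i" using w k
        by (subst Q_mult[OF c(1)]) (auto simp: P_mult[OF w])
    qed (use w in \<open>auto simp: P_def Q_def\<close>)
    show "P *\<^sub>v (Q *\<^sub>v w) = w"
    proof (rule eq_vecI)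
      fix i assume "i < dim_vec w"
      then show "(P *\<^sub>v (Q *\<^sub>v w)) $ i = w $ i" using w k
        by (subst P_mult[OF c(2)]) (auto simp: Q_mult[OF w])
    qed (use w in \<open>auto simp: P_def Q_def\<close>)
  qed
  have unit: "M *\<^sub>v unit_vec k j = col M j" if "M \<in> carrier_mat k k" "j < k" for M :: "'a mat" and j
    using that by (intro eq_vecI) (auto simp: scalar_prod_right_unit)
  have mat_eq: "M = N" if M: "M \<in> carrier_mat k k" and N: "N \<in> carrier_mat k k"
    and "\<And>w. w \<in> carrier_vec k \<Longrightarrow> M *\<^sub>v w = N *\<^sub>v w" for M N :: "'a mat"
  proof (rule mat_col_eqI)
    fix j assume "j < dim_col N"
    then show "col M j = col N j" using unit[OF M] unit[OF N] that(3)[of "unit_vec k j"] N by auto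
  qed (use M N in auto)
  have QP: "Q * P = 1\<^sub>m k"
    by (rule mat_eq) (use PQ in \<open>auto simp: assoc_mult_mat_vec[OF PQ(2) PQ(1)] QPw\<close>)
  have PQ1: "P * Q = 1\<^sub>m k"
    by (rule mat_eq) (use PQ in \<open>auto simp: assoc_mult_mat_vec[OF PQ(1) PQ(2)] PQw\<close>)
  define B where "B = Q * A * P"
  have B: "B \<in> carrier_mat k k" using A PQ by (auto simp: B_def)
  have Bw: "B *\<^sub>v w = Q *\<^sub>v (A *\<^sub>v (P *\<^sub>v w))" if "w \<in> carrier_vec k" for w
    using that A PQ by (simp add: B_def assoc_mult_mat_vec[of _ k k _ k] mult_mat_vec_carrier[of _ k k])
  have "P * B * Q = (P * Q) * A * (P * Q)"
    unfolding B_def using A PQ by (simp add: assoc_mult_mat[of _ k k _ k _ k])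
  then have "A = P * B * Q" using QP PQ1 A by simp
  then have "similar_mat A B" using A B QP PQ1 PQ by (intro similar_matI[of _ _ P Q k]) auto
  then have cp: "char_poly A = char_poly B" by (rule char_poly_similar)
  have P0: "P *\<^sub>v unit_vec k 0 = vec k (\<lambda>_. 1)"
    unfolding unit[OF PQ(1) k] by (rule eq_vecI) (use k in \<open>auto simp: P_def\<close>)
  have "B *\<^sub>v unit_vec k 0 = 0\<^sub>v k"
    unfolding Bw[OF unit_vec_carrier] P0 ones by (rule eq_vecI) (use PQ in auto)
  then have "col B 0 = 0\<^sub>v k" using unit[OF B k] by simp
  then have "B $$ (j, 0) = 0" if "j < k" for j
    using that B k by (metis carrier_matD index_col index_zero_vec(1))
  from char_poly_0_column[OF this B k] cp
  have "char_poly A = [:0, 1:] * char_poly (mat_delete B 0 0)"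
    by (simp add: monom_altdef)
  moreover have "poly (char_poly (mat_delete B 0 0)) 0 \<noteq> 0"
  proof
    define C where "C = mat_delete B 0 0"
    have C: "C \<in> carrier_mat (k - 1) (k - 1)" using B by (simp add: C_def mat_delete_def)
    assume "poly (char_poly (mat_delete B 0 0)) 0 = 0"
    then have "eigenvalue C 0" using eigenvalue_root_char_poly[OF C] by (simp add: C_def)
    moreover have "0 \<cdot>\<^sub>v x = 0\<^sub>v (k - 1)" if "x \<in> carrier_vec (k - 1)" for x :: "'a vec"
      using that by auto
    ultimately obtain x where x: "x \<in> carrier_vec (k - 1)" "x \<noteq> 0\<^sub>v (k - 1)" "C *\<^sub>v x = 0\<^sub>v (k - 1)"
      using C unfolding eigenvalue_def eigenvector_def by (metis carrier_matD(1))
    \<comment> \<open>Padding the kernel vector of the minor with a leading 0 kills every entry of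
      \<open>B *\<^sub>v w\<close> but entry 0. Since \<open>P\<close> turns a vector supported at 0
      into a constant one, \<open>A *\<^sub>v w\<close> is constant.\<close>
    define w where "w = vec k (\<lambda>i. if i = 0 then 0 else x $ (i - 1))"
    have w: "w \<in> carrier_vec k" by (simp add: w_def)
    have w0: "w $ 0 = 0" using k by (simp add: w_def)
    have Pw: "P *\<^sub>v w = w" 
      by (rule eq_vecI) (use w w0 PQ in \<open>auto simp: P_mult[OF w] simp del: index_mult_mat_vec\<close>)
    have Bwi: "(B *\<^sub>v w) $ i = 0" if i: "i < k" "i \<noteq> 0" for i
    proof -
      have "(B *\<^sub>v w) $ i = (\<Sum>j<k. B $$ (i, j) * w $ j)"
        using i B w by (simp add: scalar_prod_def lessThan_atLeast0)
      also have "\<dots> = (\<Sum>j<Suc (k - 1). B $$ (i, j) * w $ j)" using k by simp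
      also have "\<dots> = (\<Sum>j<k - 1. B $$ (i, Suc j) * w $ Suc j)"
        unfolding sum.lessThan_Suc_shift using w0 by simp
      also have "\<dots> = (\<Sum>j<k - 1. C $$ (i - 1, j) * x $ j)"
        using i B by (intro sum.cong) (auto simp: C_def mat_delete_def w_def)
      also have "\<dots> = (C *\<^sub>v x) $ (i - 1)"
        using i C x(1) by (simp add: scalar_prod_def lessThan_atLeast0)
      finally show ?thesis using x i by simp
    qed
    have AwC: "A *\<^sub>v w \<in> carrier_vec k" using mult_mat_vec_carrier[OF A w] .
    have "A *\<^sub>v w = P *\<^sub>v (B *\<^sub>v w)" using Bw[OF w] Pw PQw[OF AwC] by simp
    also have "\<dots> = vec k (\<lambda>_. (B *\<^sub>v w) $ 0)"
      by (rule eq_vecI) (use B w Bwi PQ in \<open>auto simp: P_mult[OF mult_mat_vec_carrier[OF B w]] simp del: index_mult_mat_vec\<close>)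
    finally have "w = 0\<^sub>v k" using ker w w0 by blast
    moreover have "x $ i = w $ (Suc i)" if "i < k - 1" for i using that by (simp add: w_def)
    ultimately have "x = 0\<^sub>v (k - 1)" using x(1) by (intro eq_vecI) auto
    then show False using x(2) by simp
  qed
  ultimately show ?thesis by blast
qed

section \<open>The eigenvector equations\<close>

text \<open>The system \<open>L w = z w + c 1\<close> for \<open>w = (u, v)\<close>, where \<open>u n = u 0\<close> closes the cycle so that
  only node \<open>0\<close> needs a separate equation. The inhomogeneity \<open>c\<close> serves to show that \<open>0\<close> is simple.\<close>

definition network_system ::
  "nat \<Rightarrow> nat \<Rightarrow> real vec \<Rightarrow> complex \<Rightarrow> complex \<Rightarrow> (nat \<Rightarrow> complex) \<Rightarrow> (nat \<Rightarrow> complex) \<Rightarrow> bool"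
where
  "network_system n m d z c u v \<longleftrightarrow>
     u n = u 0 \<and>
     2 * u 0 - u 1 - u (n - 1) + of_real (total_weight d) * u 0 - (\<Sum>j<m. of_real (d $ j) * v j)
       = z * u 0 + c \<and>
     (\<forall>i\<in>{1..<n}. 2 * u i - u (i - 1) - u (i + 1) = z * u i + c) \<and>
     of_nat m * v 0 - (\<Sum>j\<in>{1..<m}. v j) - u 0 = z * v 0 + c \<and>
     (\<forall>j\<in>{1..<m}. v j - v 0 = z * v j + c)"

lemma network_system_cong:
  assumes n: "n \<ge> 3" and m: "m \<ge> 1"
    and u: "\<And>i. i \<le> n \<Longrightarrow> u i = u' i" and v: "\<And>j. j < m \<Longrightarrow> v j = v' j"
  shows "network_system n m d z c u v \<longleftrightarrow> network_system n m d z c u' v'"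
proof -
  have "u n = u' n" "u 0 = u' 0" "u 1 = u' 1" "u (n - 1) = u' (n - 1)" "v 0 = v' 0"
    using n m u v by auto
  moreover have "(\<Sum>j<m. of_real (d $ j) * v j) = (\<Sum>j<m. of_real (d $ j) * v' j)"
      "(\<Sum>j\<in>{1..<m}. v j) = (\<Sum>j\<in>{1..<m}. v' j)"
    using v by (auto intro!: sum.cong)
  moreover have "(\<forall>i\<in>{1..<n}. 2 * u i - u (i - 1) - u (i + 1) = z * u i + c) \<longleftrightarrow>
      (\<forall>i\<in>{1..<n}. 2 * u' i - u' (i - 1) - u' (i + 1) = z * u' i + c)"
    using u by (intro ball_cong) auto
  moreover have "(\<forall>j\<in>{1..<m}. v j - v 0 = z * v j + c) \<longleftrightarrow>
      (\<forall>j\<in>{1..<m}. v' j - v' 0 = z * v' j + c)"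
    using v m by (intro ball_cong) auto
  ultimately show ?thesis unfolding network_system_def by simp
qed

section \<open>The modified Laplacian acting on vectors\<close>

lemma L_Gp_carrier [simp]:
  assumes "d \<in> carrier_vec m"
  shows "L_Gp n m d \<in> carrier_mat (n + m) (n + m)"
  using assms by (auto simp: L_Gp_def cycle_laplacian_def star_laplacian_def corner_mat_def first_row_mat_def)

text \<open>The unmodified graph becomes the case of zero weights. As \<open>modification\<close>
  excludes the zero vector, the results used for both graphs constrain the weights by inequalities
  such as \<open>d $ 0 \<le> total_weight d\<close> instead.\<close>

lemma L_G_eq_L_Gp: "L_G n m = L_Gp n m (0\<^sub>v m)"
  unfolding L_G_def L_Gp_def
  by (rule arg_cong4[where f = four_block_mat])
    (auto simp: cycle_laplacian_def corner_mat_def first_row_mat_def total_weight_def)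

lemma cycle_laplacian_row_sum:
  fixes u :: "nat \<Rightarrow> complex"
  assumes n: "n \<ge> 3" and i: "i < n"
  shows "(\<Sum>j<n. of_real (cycle_laplacian n $$ (i, j)) * u j) =
    2 * u i - u (if i = 0 then n - 1 else i - 1) - u (if i = n - 1 then 0 else i + 1)"
proof -
  define p where "p = (if i = 0 then n - 1 else i - 1)"
  define s where "s = (if i = n - 1 then 0 else i + 1)"
  \<comment> \<open>Here \<open>n \<ge> 3\<close> matters: the two cyclic neighbours differ, so the
    row has two separate entries -1.\<close>
  have ps: "i \<noteq> p" "i \<noteq> s" "p \<noteq> s" "p < n" "s < n"
    using n i by (auto simp: p_def s_def)
  have entry: "cycle_laplacian n $$ (i, j) = (if j = i then 2 else if j = s \<or> j = p then -1 else 0)"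
    if "j < n" for j
  proof -
    have "j = (i + 1) mod n \<longleftrightarrow> j = s" "i = (j + 1) mod n \<longleftrightarrow> j = p"
      using that i n by (auto simp: p_def s_def mod_if)
    then show ?thesis using i that by (simp add: cycle_laplacian_def)
  qed
  have "(\<Sum>j<n. of_real (cycle_laplacian n $$ (i, j)) * u j) =
    (\<Sum>j<n. (if j = i then 2 * u i else 0) + (if j = p then - u p else 0) + (if j = s then - u s else 0))"
    using ps by (intro sum.cong) (auto simp: entry)
  also have "\<dots> = 2 * u i - u p - u s"
    using i ps by (simp add: sum.distrib)
  finally show ?thesis by (simp add: p_def s_def)
qed

lemma corner_mat_row_sum:
  fixes u :: "nat \<Rightarrow> complex"
  assumes "i < r" "0 < k"
  shows "(\<Sum>j<k. of_real (corner_mat r k x $$ (i, j)) * u j) = (if i = 0 then of_real x * u 0 else 0)"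
proof -
  have "(\<Sum>j<k. of_real (corner_mat r k x $$ (i, j)) * u j) =
      (\<Sum>j<k. if j = 0 then (if i = 0 then of_real x * u 0 else 0) else 0)"
    using assms by (intro sum.cong) (auto simp: corner_mat_def)
  also have "\<dots> = (if i = 0 then of_real x * u 0 else 0)"
    using assms by simp
  finally show ?thesis .
qed

lemma star_laplacian_row_sum:
  fixes v :: "nat \<Rightarrow> complex"
  assumes i: "i < m"
  shows "(\<Sum>j<m. of_real (star_laplacian m $$ (i, j)) * v j) =
    (if i = 0 then (of_nat m - 1) * v 0 - (\<Sum>j\<in>{1..<m}. v j) else v i - v 0)"
proof -
  have split: "{..<m} = insert 0 {1..<m}" using i by auto
  show ?thesis
  proof (cases "i = 0")
    case True
    have "(\<Sum>j<m. of_real (star_laplacian m $$ (i, j)) * v j) =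
      (of_nat m - 1) * v 0 + (\<Sum>j\<in>{1..<m}. of_real (star_laplacian m $$ (i, j)) * v j)"
      unfolding split using True i by (simp add: star_laplacian_def)
    also have "(\<Sum>j\<in>{1..<m}. of_real (star_laplacian m $$ (i, j)) * v j) = (\<Sum>j\<in>{1..<m}. - v j)"
      using True i by (intro sum.cong) (auto simp: star_laplacian_def)
    finally show ?thesis using True by (simp add: sum_negf)
  next
    case False
    have "(\<Sum>j<m. of_real (star_laplacian m $$ (i, j)) * v j) =
      (\<Sum>j<m. (if j = i then v i else 0) + (if j = 0 then - v 0 else 0))"
      using i False by (intro sum.cong) (auto simp: star_laplacian_def)
    also have "\<dots> = v i - v 0" using i by (simp add: sum.distrib)
    finally show ?thesis using False by simp
  qed
qed

lemma L_Gp_mult_vec: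
  fixes w :: "complex vec"
  assumes n: "n \<ge> 3" and m: "m \<ge> 1" and d: "d \<in> carrier_vec m" and w: "w \<in> carrier_vec (n + m)"
    and i: "i < n + m"
  shows "(complex_mat (L_Gp n m d) *\<^sub>v w) $ i =
    (if i < n then
       2 * w $ i - w $ (if i = 0 then n - 1 else i - 1) - w $ (if i = n - 1 then 0 else i + 1)
       + (if i = 0 then of_real (total_weight d) * w $ 0 - (\<Sum>j<m. of_real (d $ j) * w $ (n + j)) else 0)
     else if i = n then of_nat m * w $ n - (\<Sum>j\<in>{1..<m}. w $ (n + j)) - w $ 0
     else w $ i - w $ n)"
proof -
  define A where "A = L_Gp n m d"
  have A: "A \<in> carrier_mat (n + m) (n + m)" using d by (simp add: A_def)
  have split: "{..<n + m} = {..<n} \<union> ((+) n) ` {..<m}"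
    by (auto simp: image_iff) (metis add_diff_inverse_nat lessThan_iff nat_add_left_cancel_less)
  have "(complex_mat A *\<^sub>v w) $ i = (\<Sum>j<n + m. of_real (A $$ (i, j)) * w $ j)"
    using A w i by (simp add: scalar_prod_def lessThan_atLeast0)
  also have "\<dots> = (\<Sum>j<n. of_real (A $$ (i, j)) * w $ j) + (\<Sum>j<m. of_real (A $$ (i, n + j)) * w $ (n + j))"
    unfolding split by (subst sum.union_disjoint) (auto simp: sum.reindex)
  finally have eq: "(complex_mat A *\<^sub>v w) $ i = \<dots>" .
  show ?thesis
  proof (cases "i < n")
    case True
    have "(\<Sum>j<n. of_real (A $$ (i, j)) * w $ j) =
      (\<Sum>j<n. of_real (cycle_laplacian n $$ (i, j)) * w $ j) +
      (\<Sum>j<n. of_real (corner_mat n n (total_weight d) $$ (i, j)) * w $ j)"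
      unfolding sum.distrib[symmetric] using True d
      by (intro sum.cong) (auto simp: A_def L_Gp_def cycle_laplacian_def corner_mat_def
         star_laplacian_def first_row_mat_def algebra_simps)
    moreover have "(\<Sum>j<m. of_real (A $$ (i, n + j)) * w $ (n + j)) =
      (\<Sum>j<m. if i = 0 then - (of_real (d $ j) * w $ (n + j)) else 0)"
      using True d
      by (intro sum.cong) (auto simp: A_def L_Gp_def cycle_laplacian_def corner_mat_def
         star_laplacian_def first_row_mat_def)
    ultimately show ?thesis
      using eq True n unfolding A_def
      by (simp add: cycle_laplacian_row_sum corner_mat_row_sum sum_negf del: One_nat_def)
  next
    case False
    define k where "k = i - n"
    have k: "i = n + k" "k < m" using False i by (auto simp: k_def)
    have "(\<Sum>j<n. of_real (A $$ (i, j)) * w $ j) = (\<Sum>j<n. of_real (corner_mat m n (-1) $$ (k, j)) * w $ j)"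
      using k d
      by (intro sum.cong) (auto simp: A_def L_Gp_def cycle_laplacian_def corner_mat_def
         star_laplacian_def first_row_mat_def)
    moreover have "(\<Sum>j<m. of_real (A $$ (i, n + j)) * w $ (n + j)) =
      (\<Sum>j<m. of_real (star_laplacian m $$ (k, j)) * w $ (n + j)) +
      (\<Sum>j<m. of_real (corner_mat m m 1 $$ (k, j)) * w $ (n + j))"
      unfolding sum.distrib[symmetric] using k d
      by (intro sum.cong) (auto simp: A_def L_Gp_def cycle_laplacian_def corner_mat_def
         star_laplacian_def first_row_mat_def algebra_simps)
    moreover have "(\<Sum>j<n. of_real (corner_mat m n (-1) $$ (k, j)) * w $ j) =
        (if k = 0 then of_real (-1) * w $ 0 else 0)"
      using k n by (intro corner_mat_row_sum) auto
    moreover have "(\<Sum>j<m. of_real (corner_mat m m 1 $$ (k, j)) * w $ (n + j)) =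
        (if k = 0 then of_real 1 * w $ (n + 0) else 0)"
      using k n by (intro corner_mat_row_sum) auto
    ultimately show ?thesis
      using eq False k n unfolding A_def
      by (cases "k = 0") (auto simp: star_laplacian_row_sum ring_distribs)
  qed
qed

text \<open>Indexing by \<open>i mod n\<close> makes the closing condition \<open>u n = u 0\<close>
  automatic. Both directions serve: eigenvectors yield solutions, and explicit solutions yield
  eigenvectors.\<close>

lemma L_Gp_mult_vec_iff_system:
  fixes w :: "complex vec"
  assumes n: "n \<ge> 3" and m: "m \<ge> 1" and d: "d \<in> carrier_vec m" and w: "w \<in> carrier_vec (n + m)"
  shows "complex_mat (L_Gp n m d) *\<^sub>v w = vec (n + m) (\<lambda>i. z * w $ i + c) \<longleftrightarrow>
    network_system n m d z c (\<lambda>i. w $ (i mod n)) (\<lambda>j. w $ (n + j))"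
proof -
  define R where "R = complex_mat (L_Gp n m d) *\<^sub>v w"
  have R: "R \<in> carrier_vec (n + m)"
    unfolding R_def by (rule mult_mat_vec_carrier[OF _ w]) (simp add: d)
  note Ri = L_Gp_mult_vec[OF n m d w, folded R_def]
  have "R = vec (n + m) (\<lambda>i. z * w $ i + c) \<longleftrightarrow> (\<forall>i<n + m. R $ i = z * w $ i + c)"
    using R by (auto simp: vec_eq_iff)
  also have "\<dots> \<longleftrightarrow> (\<forall>i<n. R $ i = z * w $ i + c) \<and> (\<forall>j<m. R $ (n + j) = z * w $ (n + j) + c)"
    by (auto, metis add_diff_inverse_nat nat_add_left_cancel_less)
  also have "(\<forall>i<n. R $ i = z * w $ i + c) \<longleftrightarrow> 
     R $ 0 = z * w $ 0 + c \<and> (\<forall>i\<in>{1..<n}. R $ i = z * w $ i + c)"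
    using n by (auto simp: Ball_def) (metis One_nat_def Suc_leI gr_zeroI)
  also have "(\<forall>j<m. R $ (n + j) = z * w $ (n + j) + c) \<longleftrightarrow>
     R $ n = z * w $ n + c \<and> (\<forall>j\<in>{1..<m}. R $ (n + j) = z * w $ (n + j) + c)"
    using m by (auto simp: Ball_def) (metis One_nat_def Suc_leI add_0_right gr_zeroI)
  also have "(\<forall>i\<in>{1..<n}. R $ i = z * w $ i + c) \<longleftrightarrow>
     (\<forall>i\<in>{1..<n}. 2 * w $ (i mod n) - w $ ((i - 1) mod n) - w $ ((i + 1) mod n) = z * w $ (i mod n) + c)"
  proof (intro ball_cong refl)
    fix i assume i: "i \<in> {1..<n}"
    then have "(i + 1) mod n = (if i = n - 1 then 0 else i + 1)" "i mod n = i" "(i - 1) mod n = i - 1"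
      using n by (auto simp: mod_if)
    then show "R $ i = z * w $ i + c \<longleftrightarrow> 
      2 * w $ (i mod n) - w $ ((i - 1) mod n) - w $ ((i + 1) mod n) = z * w $ (i mod n) + c"
      using Ri[of i] i by simp
  qed
  also have "R $ 0 = 2 * w $ 0 - w $ 1 - w $ (n - 1) + of_real (total_weight d) * w $ 0
      - (\<Sum>j<m. of_real (d $ j) * w $ (n + j))"
    using Ri[of 0] n by simp
  also have "R $ n = of_nat m * w $ n - (\<Sum>j\<in>{1..<m}. w $ (n + j)) - w $ 0"
    using Ri[of n] m by simp
  also have "(\<forall>j\<in>{1..<m}. R $ (n + j) = z * w $ (n + j) + c) \<longleftrightarrow>
      (\<forall>j\<in>{1..<m}. w $ (n + j) - w $ n = z * w $ (n + j) + c)"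
    using Ri by (intro ball_cong) auto
  finally show ?thesis using n unfolding R_def network_system_def by auto
qed

lemma eigenvalue_imp_system:
  assumes n: "n \<ge> 3" and m: "m \<ge> 1" and d: "d \<in> carrier_vec m"
    and ev: "eigenvalue (complex_mat (L_Gp n m d)) z"
  obtains u v where "network_system n m d z 0 u v" "(\<exists>i<n. u i \<noteq> 0) \<or> (\<exists>j<m. v j \<noteq> 0)"
proof -
  have A: "L_Gp n m d \<in> carrier_mat (n + m) (n + m)" using d by simp
  obtain w where w: "w \<in> carrier_vec (n + m)" "w \<noteq> 0\<^sub>v (n + m)"
    and eq: "complex_mat (L_Gp n m d) *\<^sub>v w = z \<cdot>\<^sub>v w"
    using ev A by (auto simp: eigenvalue_def eigenvector_def)
  have "z \<cdot>\<^sub>v w = vec (n + m) (\<lambda>i. z * w $ i + 0)" using w by auto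
  with eq have "network_system n m d z 0 (\<lambda>i. w $ (i mod n)) (\<lambda>j. w $ (n + j))"
    using L_Gp_mult_vec_iff_system[OF n m d w(1)] by metis
  moreover have "\<exists>i<n + m. w $ i \<noteq> 0" using w by (auto simp: vec_eq_iff)
  then obtain i where i: "i < n + m" "w $ i \<noteq> 0" by blast
  then have "(\<exists>i<n. w $ (i mod n) \<noteq> 0) \<or> (\<exists>j<m. w $ (n + j) \<noteq> 0)"
  proof (cases "i < n")
    case False
    then have "w $ (n + (i - n)) \<noteq> 0" "i - n < m" using i by auto
    then show ?thesis by blast
  qed (use i in auto)
  ultimately show ?thesis using that by blast
qed

lemma system_imp_eigenvalue:
  assumes n: "n \<ge> 3" and m: "m \<ge> 1" and d: "d \<in> carrier_vec m"
    and sys: "network_system n m d z 0 u v" and nz: "v 0 \<noteq> 0"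
  shows "eigenvalue (complex_mat (L_Gp n m d)) z"
proof -
  have A: "L_Gp n m d \<in> carrier_mat (n + m) (n + m)" using d by simp
  define w where "w = vec (n + m) (\<lambda>i. if i < n then u i else v (i - n))"
  have w: "w \<in> carrier_vec (n + m)" by (simp add: w_def)
  have wu: "w $ (i mod n) = u i" if "i \<le> n" for i
    using that n sys by (cases "i = n") (auto simp: w_def network_system_def)
  have wv: "w $ (n + j) = v j" if "j < m" for j
    using that by (simp add: w_def)
  have "network_system n m d z 0 (\<lambda>i. w $ (i mod n)) (\<lambda>j. w $ (n + j))"
    using sys network_system_cong[OF n m wu wv] by simp
  then have "complex_mat (L_Gp n m d) *\<^sub>v w = vec (n + m) (\<lambda>i. z * w $ i + 0)"
    using L_Gp_mult_vec_iff_system[OF n m d w] by metis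
  also have "\<dots> = z \<cdot>\<^sub>v w" using w by auto
  finally have "complex_mat (L_Gp n m d) *\<^sub>v w = z \<cdot>\<^sub>v w" .
  moreover have "w \<noteq> 0\<^sub>v (n + m)"
    using wv[of 0] nz m by auto
  ultimately show ?thesis using w A by (auto simp: eigenvalue_def eigenvector_def)
qed

section \<open>Star response and cycle energy\<close>

text \<open>The discriminant lies strictly between (m - 1)^2 and (m + 1)^2, which traps its square
  root; sum and product are Vieta's relations.\<close>

lemma beta_facts:
  assumes "m \<ge> 2"
  shows "0 < beta_minus m" "beta_minus m < 1" "real m < beta_plus m"
    "beta_minus m + beta_plus m = real m + 1" "beta_minus m * beta_plus m = 1"
proof -
  define s where "s = sqrt ((real m + 1)\<^sup>2 - 4)"
  have m: "real m \<ge> 2" using assms by simp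
  have "(real m + 1)\<^sup>2 - 4 = (real m - 1)\<^sup>2 + (4 * real m - 4)" by (simp add: power2_eq_square algebra_simps)
  then have nn: "(real m - 1)\<^sup>2 < (real m + 1)\<^sup>2 - 4" using m by simp
  then have "(real m + 1)\<^sup>2 - 4 \<ge> 0" using zero_le_power2[of "real m - 1"] by linarith
  then have s2: "s\<^sup>2 = (real m + 1)\<^sup>2 - 4" by (simp add: s_def)
  have "s < real m + 1" unfolding s_def using m by (intro real_less_lsqrt) auto
  moreover have "real m - 1 < s" unfolding s_def using nn by (rule real_less_rsqrt)
  moreover have b: "beta_minus m = (real m + 1 - s) / 2" "beta_plus m = (real m + 1 + s) / 2"
    by (auto simp: beta_minus_def beta_plus_def s_def)
  ultimately show "0 < beta_minus m" "beta_minus m < 1" "real m < beta_plus m"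
    by auto
  show "beta_minus m + beta_plus m = real m + 1" by (simp add: b field_simps)
  have "beta_minus m * beta_plus m = ((real m + 1)\<^sup>2 - s\<^sup>2) / 4"
    by (simp add: b power2_eq_square algebra_simps)
  then show "beta_minus m * beta_plus m = 1" by (simp add: s2)
qed

text \<open>The roots are the eigenvalues other than 1 of the star block
  \<open>star_laplacian m + corner_mat m m 1\<close>. The type class admits both real and complex
  \<open>x\<close>.\<close>

lemma star_quadratic_factor:
  fixes x :: "'a :: {real_algebra_1, comm_ring_1}"
  assumes "m \<ge> 2"
  shows "x\<^sup>2 - (of_nat m + 1) * x + 1 = (x - of_real (beta_minus m)) * (x - of_real (beta_plus m))"
proof -
  have "of_real (beta_minus m) + of_real (beta_plus m) = (of_nat m + 1 :: 'a)"
    using arg_cong[OF beta_facts(4)[OF assms], of "of_real :: real \<Rightarrow> 'a"] by simp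
  moreover have "of_real (beta_minus m) * of_real (beta_plus m) = (1 :: 'a)"
    using arg_cong[OF beta_facts(5)[OF assms], of "of_real :: real \<Rightarrow> 'a"] by simp
  moreover have "(x - p) * (x - q) = x\<^sup>2 - (p + q) * x + p * q" for p q :: 'a
    by (simp add: power2_eq_square algebra_simps)
  ultimately show ?thesis by metis
qed

lemma total_weight_split:
  assumes "d \<in> carrier_vec m" "m \<ge> 1"
  shows "total_weight d = d $ 0 + (\<Sum>j\<in>{1..<m}. d $ j)"
proof -
  have "{..<m} = insert 0 {1..<m}" using assms(2) by auto
  then show ?thesis using assms by (simp add: total_weight_def)
qed

lemma modification_weights:
  assumes "modification m d" "m \<ge> 1"
  shows "0 < total_weight d" "0 \<le> d $ 0" "d $ 0 \<le> total_weight d"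
proof -
  have d: "d \<in> carrier_vec m" "d \<noteq> 0\<^sub>v m" "\<And>i. i < m \<Longrightarrow> 0 \<le> d $ i"
    using assms(1) by (auto simp: modification_def)
  obtain k where k: "k < m" "d $ k \<noteq> 0" using d by (auto simp: vec_eq_iff)
  then have "0 < d $ k" using d(3)[of k] by linarith
  moreover have "d $ k \<le> (\<Sum>i<dim_vec d. d $ i)"
    using k d by (intro member_le_sum) auto
  ultimately show "0 < total_weight d" by (simp add: total_weight_def)
  show "0 \<le> d $ 0" using d assms(2) by simp
  show "d $ 0 \<le> total_weight d"
    using d by (auto simp: total_weight_split[OF d(1) assms(2)] intro!: sum_nonneg)
qed

text \<open>A leaf sees only the hub, so all leaves agree and can be eliminated from the hub
  equation. The last two claims are kept free of division, hence usable at
  \<open>beta_minus m\<close> itself.\<close>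

lemma star_response:
  assumes m: "m \<ge> 2" and d: "d \<in> carrier_vec m" and z: "z \<noteq> 1"
    and sys: "network_system n m d z 0 u v"
  shows "\<And>j. j \<in> {1..<m} \<Longrightarrow> v j = v 0 / (1 - z)"
    and "(z - of_real (beta_minus m)) * (z - of_real (beta_plus m)) * v 0 = (1 - z) * u 0"
    and "(1 - z) * (\<Sum>j<m. of_real (d $ j) * v j) = (of_real (total_weight d) - of_real (d $ 0) * z) * v 0"
proof -
  have leaf: "v j = v 0 / (1 - z)" if "j \<in> {1..<m}" for j
  proof -
    have "v j - v 0 = z * v j" using sys that unfolding network_system_def by auto
    then show ?thesis using z by (simp add: field_simps)
  qed
  then show "\<And>j. j \<in> {1..<m} \<Longrightarrow> v j = v 0 / (1 - z)" .
  have "of_nat m * v 0 - (\<Sum>j\<in>{1..<m}. v j) - u 0 = z * v 0"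
    using sys unfolding network_system_def by simp
  moreover have "(\<Sum>j\<in>{1..<m}. v j) = (of_nat m - 1) * v 0 / (1 - z)"
    using leaf m by (simp add: of_nat_diff)
  ultimately have "of_nat m * v 0 - (of_nat m - 1) * v 0 / (1 - z) - u 0 = z * v 0" by simp
  then have "of_nat m * v 0 * (1 - z) - (of_nat m - 1) * v 0 - u 0 * (1 - z) = z * v 0 * (1 - z)"
    using z by (simp add: field_simps)
  then have "(z\<^sup>2 - (of_nat m + 1) * z + 1) * v 0 = (1 - z) * u 0"
    by (simp add: power2_eq_square algebra_simps)
  then show "(z - of_real (beta_minus m)) * (z - of_real (beta_plus m)) * v 0 = (1 - z) * u 0"
    using star_quadratic_factor[OF m] by metis
  have split: "{..<m} = insert 0 {1..<m}" using m by auto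
  have "(\<Sum>j<m. of_real (d $ j) * v j) =
      of_real (d $ 0) * v 0 + (\<Sum>j\<in>{1..<m}. of_real (d $ j)) * (v 0 / (1 - z))"
    unfolding split sum_distrib_right using leaf by simp
  then have "(1 - z) * (\<Sum>j<m. of_real (d $ j) * v j) =
      (of_real (d $ 0) * (1 - z) + (\<Sum>j\<in>{1..<m}. of_real (d $ j))) * v 0"
    using z by (simp add: field_simps)
  also have "\<dots> = (of_real (total_weight d) - of_real (d $ 0) * z) * v 0"
    using m by (simp add: total_weight_split[OF d] algebra_simps)
  finally show "(1 - z) * (\<Sum>j<m. of_real (d $ j) * v j) =
      (of_real (total_weight d) - of_real (d $ 0) * z) * v 0" .
qed

text \<open>Summation by parts on a path. When \<open>u k = u 0\<close>, the two boundary terms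
  merge into the row of the cycle Laplacian at node 0, paired with \<open>cnj (u 0)\<close>.\<close>

lemma discrete_Green:
  fixes u :: "nat \<Rightarrow> complex"
  assumes "k \<ge> 1"
  shows "(\<Sum>i<k. of_real ((cmod (u (i + 1) - u i))\<^sup>2)) =
    cnj (u k) * (u k - u (k - 1)) - cnj (u 0) * (u 1 - u 0)
    + (\<Sum>i\<in>{1..<k}. cnj (u i) * (2 * u i - u (i - 1) - u (i + 1)))"
  using assms
proof (induction k rule: nat_induct_at_least)
  case base
  show ?case by (simp add: complex_norm_square algebra_simps del: of_real_power)
next
  case (Suc k)
  have "{1..<Suc k} = insert k {1..<k}" using Suc.hyps by auto
  then show ?case using Suc
    by (simp add: complex_norm_square algebra_simps del: of_real_power)
qed

text \<open>\<open>E\<close> is the Dirichlet energy of \<open>u\<close> on the cycle. Its identity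
  comes from pairing every cycle row with \<open>cnj (u i)\<close>; the bound \<open>4 * N\<close>
  is obtained edge by edge.\<close>

lemma network_energy:
  fixes u :: "nat \<Rightarrow> complex"
  assumes n: "n \<ge> 1" and sys: "network_system n m d z 0 u v"
  defines "N \<equiv> \<Sum>i<n. (cmod (u i))\<^sup>2"
  obtains E where "0 \<le> E" "E \<le> 4 * N"
    "of_real E = z * of_real N + cnj (u 0) * (\<Sum>j<m. of_real (d $ j) * v j)
      - of_real (total_weight d) * of_real ((cmod (u 0))\<^sup>2)"
proof
  define E where "E = (\<Sum>i<n. (cmod (u (i + 1) - u i))\<^sup>2)"
  show "0 \<le> E" by (auto simp: E_def intro: sum_nonneg)
  have un: "u n = u 0" using sys by (simp add: network_system_def)
  have shift: "(\<Sum>i<n. (cmod (u (i + 1)))\<^sup>2) = N"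
  proof -
    have "(\<Sum>i<n. (cmod (u (i + 1)))\<^sup>2) + (cmod (u 0))\<^sup>2 = (\<Sum>i<Suc n. (cmod (u i))\<^sup>2)"
      unfolding sum.lessThan_Suc_shift by simp
    then show ?thesis by (simp add: N_def un)
  qed
  have "(cmod (x - y))\<^sup>2 \<le> 2 * (cmod x)\<^sup>2 + 2 * (cmod y)\<^sup>2" for x y
  proof -
    have "(cmod (x - y))\<^sup>2 \<le> (cmod x + cmod y)\<^sup>2"
      by (intro power_mono norm_triangle_ineq4) auto
    also have "\<dots> \<le> 2 * (cmod x)\<^sup>2 + 2 * (cmod y)\<^sup>2"
      using zero_le_power2[of "cmod x - cmod y"] by (simp add: power2_eq_square algebra_simps)
    finally show ?thesis .
  qed
  then have "E \<le> (\<Sum>i<n. 2 * (cmod (u (i + 1)))\<^sup>2 + 2 * (cmod (u i))\<^sup>2)"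
    unfolding E_def by (intro sum_mono) auto
  also have "\<dots> = 2 * (\<Sum>i<n. (cmod (u (i + 1)))\<^sup>2) + 2 * N"
    by (simp add: sum.distrib sum_distrib_left N_def)
  finally show "E \<le> 4 * N" using shift by simp
  have split: "{..<n} = insert 0 {1..<n}" using n by auto
  have "of_real E = cnj (u 0) * (u 0 - u (n - 1)) - cnj (u 0) * (u 1 - u 0)
    + (\<Sum>i\<in>{1..<n}. cnj (u i) * (2 * u i - u (i - 1) - u (i + 1)))"
    unfolding E_def of_real_sum discrete_Green[OF n] un ..
  also have "(\<Sum>i\<in>{1..<n}. cnj (u i) * (2 * u i - u (i - 1) - u (i + 1))) =
      (\<Sum>i\<in>{1..<n}. z * of_real ((cmod (u i))\<^sup>2))"
    using sys unfolding network_system_def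
    by (intro sum.cong) (auto simp: complex_norm_square simp del: of_real_power)
  also have "\<dots> = z * of_real N - z * of_real ((cmod (u 0))\<^sup>2)"
    unfolding N_def split by (simp add: sum_distrib_left algebra_simps)
  also have "cnj (u 0) * (u 0 - u (n - 1)) - cnj (u 0) * (u 1 - u 0) =
      cnj (u 0) * (2 * u 0 - u 1 - u (n - 1))" by (simp add: algebra_simps)
  also have "2 * u 0 - u 1 - u (n - 1) = z * u 0 - of_real (total_weight d) * u 0
      + (\<Sum>j<m. of_real (d $ j) * v j)"
    using sys unfolding network_system_def by (simp add: algebra_simps)
  finally show "of_real E = z * of_real N + cnj (u 0) * (\<Sum>j<m. of_real (d $ j) * v j)
      - of_real (total_weight d) * of_real ((cmod (u 0))\<^sup>2)"
    by (simp add: complex_norm_square algebra_simps del: of_real_power)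
qed

text \<open>\<open>N\<close> and \<open>E\<close> are squared norm and energy divided by the squared
  modulus of \<open>u 0\<close>, whence \<open>1 \<le> N\<close>. The form of \<open>zE\<close> lets
  one statement serve nonreal and negative \<open>z\<close> alike.\<close>

lemma network_response_energy:
  assumes n: "n \<ge> 3" and m: "m \<ge> 2" and d: "d \<in> carrier_vec m"
    and sys: "network_system n m d z 0 u v" and nz: "(\<exists>i<n. u i \<noteq> 0) \<or> (\<exists>j<m. v j \<noteq> 0)"
    and z1: "z \<noteq> 1" and za: "z \<noteq> of_real (beta_minus m)" and zb: "z \<noteq> of_real (beta_plus m)"
    and zE: "Im z \<noteq> 0 \<or> Re z < 0"
  obtains N E where "1 \<le> N" "0 \<le> E" "E \<le> 4 * N"
    "of_real E - z * of_real N = (of_real (total_weight d) - of_real (d $ 0) * z) /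
      ((z - of_real (beta_minus m)) * (z - of_real (beta_plus m))) - of_real (total_weight d)"
proof -
  define Q where "Q = (z - of_real (beta_minus m)) * (z - of_real (beta_plus m))"
  have Q: "Q \<noteq> 0" using za zb by (simp add: Q_def)
  define W where "W = (\<Sum>j<m. of_real (d $ j) * v j)"
  note star = star_response[OF m d z1 sys, folded Q_def W_def]
  define r where "r = (of_real (total_weight d) - of_real (d $ 0) * z) / Q"
  have v0: "v 0 = (1 - z) * u 0 / Q" using star(2) Q by (simp add: field_simps)
  have W: "W = r * u 0"
  proof -
    have "(1 - z) * W = (1 - z) * (r * u 0)" unfolding star(3) v0 r_def by simp
    then show ?thesis using z1 by simp
  qed
  define N where "N = (\<Sum>i<n. (cmod (u i))\<^sup>2)"
  obtain E where E: "0 \<le> E" "E \<le> 4 * N"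
    and eq: "of_real E = z * of_real N + cnj (u 0) * W - of_real (total_weight d) * of_real ((cmod (u 0))\<^sup>2)"
    using n by (rule network_energy[OF order.trans[of 1 3 n] sys, folded N_def W_def, rotated]) auto
  \<comment> \<open>If \<open>u 0 = 0\<close>, the star vanishes and the energy identity makes
    \<open>z\<close> the Rayleigh quotient \<open>E / N\<close>, a nonnegative real, against
    \<open>zE\<close>.\<close>
  have "u 0 \<noteq> 0"
  proof
    assume u0: "u 0 = 0"
    have "v j = 0" if "j < m" for j
      using that star(1)[of j] v0 u0 by (cases "j = 0") auto
    then obtain i where i: "i < n" "u i \<noteq> 0" using nz by blast
    have "(cmod (u i))\<^sup>2 \<le> N" unfolding N_def using i by (intro member_le_sum) auto
    then have Npos: "N > 0" using i by (smt (verit) zero_less_norm_iff zero_less_power)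
    have "of_real E = z * of_real N" using eq u0 by simp
    then have "z = of_real (E / N)" using Npos by (simp add: field_simps)
    moreover have "E / N \<ge> 0" using E Npos by simp
    ultimately show False using zE by auto
  qed
  define c where "c = (cmod (u 0))\<^sup>2"
  have c: "c > 0" using \<open>u 0 \<noteq> 0\<close> by (simp add: c_def)
  have "c \<le> N" unfolding N_def c_def using n by (intro member_le_sum) auto
  have "cnj (u 0) * W = r * of_real c"
    unfolding W c_def by (simp add: complex_norm_square algebra_simps del: of_real_power)
  then have "of_real E - z * of_real N = (r - of_real (total_weight d)) * of_real c"
    using eq by (simp add: c_def algebra_simps)
  then have "of_real (E / c) - z * of_real (N / c) = r - of_real (total_weight d)"
    using c by (simp add: field_simps)
  moreover have "1 \<le> N / c" "0 \<le> E / c" "E / c \<le> 4 * (N / c)"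
    using c E \<open>c \<le> N\<close> by (auto simp: field_simps)
  ultimately show ?thesis using that unfolding r_def Q_def by blast
qed

section \<open>Reality of the spectrum\<close>

text \<open>The rational part is A / (z - a) + B / (z - b). Each reciprocal is a conjugate over a
  squared modulus, so the factor \<open>Im z\<close> cancels from the imaginary part.\<close>

lemma response_partial_fractions:
  fixes a b s t N E :: real
  assumes ab: "a < b" and z: "Im z \<noteq> 0"
    and eq: "of_real E - z * of_real N =
      (of_real s - of_real t * z) / ((z - of_real a) * (z - of_real b)) - of_real s"
  defines "P \<equiv> (Re z - a)\<^sup>2 + (Im z)\<^sup>2" and "S \<equiv> (Re z - b)\<^sup>2 + (Im z)\<^sup>2"
    and "A \<equiv> (t * a - s) / (b - a)" and "B \<equiv> (s - t * b) / (b - a)"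
  shows "P > 0" "S > 0" "N = A / P + B / S" "E = Re z * N + A * (Re z - a) / P + B * (Re z - b) / S - s"
proof -
  have y: "(Im z)\<^sup>2 > 0" using z by simp
  show P: "P > 0" and S: "S > 0" unfolding P_def S_def using y by (auto intro: add_nonneg_pos)
  have za: "z - of_real a \<noteq> 0" "z - of_real b \<noteq> 0" using z by (auto simp: complex_eq_iff)
  have AB: "A * (b - a) = t * a - s" "B * (b - a) = s - t * b" using ab by (auto simp: A_def B_def)
  have "(of_real A * (z - of_real b) + of_real B * (z - of_real a)) * of_real (b - a) =
      of_real (A * (b - a)) * (z - of_real b) + of_real (B * (b - a)) * (z - of_real a)"
    by (simp add: algebra_simps)
  also have "\<dots> = (of_real s - of_real t * z) * of_real (b - a)"
    unfolding AB by (simp add: algebra_simps)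
  finally have num: "of_real A * (z - of_real b) + of_real B * (z - of_real a) = of_real s - of_real t * z"
    using ab by simp
  have inv: "1 / (z - of_real a) = cnj (z - of_real a) / of_real P"
    "1 / (z - of_real b) = cnj (z - of_real b) / of_real S"
    by (simp_all add: P_def S_def complex_div_cnj[of 1] cmod_power2)
  have "of_real E - z * of_real N = of_real A * (1 / (z - of_real a)) + of_real B * (1 / (z - of_real b)) - of_real s"
    unfolding eq num[symmetric] using za by (simp add: field_simps)
  then have eq': "of_real E - z * of_real N =
      of_real A * (cnj (z - of_real a) / of_real P) + of_real B * (cnj (z - of_real b) / of_real S) - of_real s"
    unfolding inv .
  have im: "Im z * N = Im z * (A / P + B / S)"
    using arg_cong[OF eq', of Im] by (simp add: algebra_simps)
  then show "N = A / P + B / S" using z by simp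
  show "E = Re z * N + A * (Re z - a) / P + B * (Re z - b) / S - s"
    using arg_cong[OF eq', of Re] by (simp add: algebra_simps)
qed

text \<open>Eliminating the residue at the larger pole \<open>b\<close> between the imaginary and the real part leaves
  an equation whose terms all stay bounded as the weights tend to zero; it traps \<open>Re z\<close> away
  from \<open>b\<close>, whereas the imaginary part alone forces \<open>z\<close> close to \<open>b\<close>.\<close>

lemma response_imp_real:
  fixes a b s t N E :: real
  assumes a: "0 < a" "a < 1" and b: "4 < b" and t: "0 \<le> t" "t \<le> s"
    and N: "1 \<le> N" and E: "0 \<le> E" "E \<le> 4 * N"
    and eq: "of_real E - z * of_real N =
      (of_real s - of_real t * z) / ((z - of_real a) * (z - of_real b)) - of_real s"
    and small: "s < t * b \<or> s < (min 1 ((b - 4) / 4))\<^sup>2"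
  shows "Im z = 0"
proof (rule ccontr)
  assume z: "Im z \<noteq> 0"
  define P where "P = (Re z - a)\<^sup>2 + (Im z)\<^sup>2"
  define S where "S = (Re z - b)\<^sup>2 + (Im z)\<^sup>2"
  define A where "A = (t * a - s) / (b - a)"
  define B where "B = (s - t * b) / (b - a)"
  have ab: "a < b" using a b by simp
  note pf = response_partial_fractions[OF ab z eq, folded P_def S_def A_def B_def]
  have "t * a \<le> s * 1" using a t by (intro mult_mono) auto
  then have A: "A \<le> 0" unfolding A_def using ab by (intro divide_nonpos_pos) auto
  then have AP: "A / P \<le> 0" using pf(1) by (intro divide_nonpos_pos)
  \<comment> \<open>The pole at \<open>a\<close> contributes nonpositively, so the pole at
    \<open>b\<close> must account for all of \<open>N\<close>. This bounds \<open>S\<close> by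
    \<open>B\<close> and forces \<open>s > t * b\<close>, leaving only the second alternative of
    \<open>small\<close>.\<close>
  have BS: "1 \<le> B / S" using pf(3) N AP by linarith
  then have B: "S \<le> B" using pf(2) by (simp add: field_simps)
  then have "B > 0" using pf(2) by simp
  then have "s > t * b" unfolding B_def using ab by (simp add: zero_less_divide_iff)
  \<comment> \<open>Staying within \<mu> of \<open>b\<close> keeps \<open>Re z\<close> at least 1
    above \<open>a\<close> and \<open>2 * Re z - b - 4\<close> at least
    \<open>(b - 4) / 2\<close>.\<close>
  define \<mu> where "\<mu> = min 1 ((b - 4) / 4)"
  have \<mu>1: "\<mu> \<le> 1" and \<mu>4: "\<mu> \<le> (b - 4) / 4"
    unfolding \<mu>_def by (rule min.cobounded1, rule min.cobounded2)
  have "0 < \<mu>" using b by (simp add: \<mu>_def)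
  note \<mu> = this \<mu>1 \<mu>4
  have s: "s < \<mu>\<^sup>2" using small \<open>s > t * b\<close> by (simp add: \<mu>_def)
  have "B \<le> s"
  proof -
    have "s - t * b \<le> s * 1" using t b by simp
    also have "\<dots> \<le> s * (b - a)" using t a b by (intro mult_left_mono) auto
    finally show ?thesis using ab by (simp add: B_def field_simps)
  qed
  have "(Re z - b)\<^sup>2 \<le> S" by (simp add: S_def)
  then have "(Re z - b)\<^sup>2 \<le> \<mu>\<^sup>2" using B \<open>B \<le> s\<close> s by linarith
  then have xb: "\<bar>Re z - b\<bar> \<le> \<mu>" using \<mu> by (simp add: abs_le_square_iff[symmetric])
  have "1 \<le> (Re z - a)\<^sup>2"
    using xb \<mu> a b by (intro one_le_power) auto
  then have P1: "1 \<le> P" by (simp add: P_def add_increasing2)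
  have "E = N * (2 * Re z - b) + A / P * (b - a) - s"
  proof -
    have "B / S = N - A / P" using pf(3) by simp
    moreover have "E = Re z * N + A / P * (Re z - a) + B / S * (Re z - b) - s" using pf(4) by simp
    ultimately have "E = Re z * N + A / P * (Re z - a) + (N - A / P) * (Re z - b) - s" by (simp only:)
    also have "Re z * N + k * (Re z - a) + (N - k) * (Re z - b) - s = N * (2 * Re z - b) + k * (b - a) - s" for k
      by (simp add: algebra_simps)
    finally show ?thesis .
  qed
  moreover have "A / P * (b - a) \<ge> - s"
  proof -
    have "A * (b - a) = t * a - s" using ab by (simp add: A_def)
    then have "A / P * (b - a) = (t * a - s) / P" by simp
    moreover have "(s - t * a) / P \<le> s / 1"
      using t a P1 by (intro frac_le) auto
    ultimately show ?thesis by (simp add: minus_divide_left[symmetric] diff_divide_distrib)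
  qed
  \<comment> \<open>The lower bound \<open>(b - 4) / 2\<close> on this product collides with the
    upper one: 2 s < 2 \<mu>^2 \<le> 2 \<mu> \<le> (b - 4) / 2.\<close>
  ultimately have "N * (2 * Re z - b - 4) \<le> 2 * s" using E by (simp add: algebra_simps)
  moreover have r: "(b - 4) / 2 \<le> 2 * Re z - b - 4" using xb \<mu> by auto
  have "1 * ((b - 4) / 2) \<le> N * (2 * Re z - b - 4)"
    by (intro mult_mono r) (use N b in auto)
  moreover have "\<mu>\<^sup>2 \<le> \<mu>" using \<mu> by (simp add: power2_eq_square mult_left_le)
  ultimately show False using s \<mu> by auto
qed

text \<open>The numerator of the response. The factor \<open>x\<close> reflects the constant
  eigenvector at 0; the other factor is nonnegative for x \<le> m and 0 \<le> t \<le> s, so signs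
  can be read off.\<close>

lemma response_numerator:
  fixes x s t :: real
  assumes "m \<ge> 2"
  shows "s - t * x - s * ((x - beta_minus m) * (x - beta_plus m)) = x * (s * (real m + 1 - x) - t)"
proof -
  have "(x - beta_minus m) * (x - beta_plus m) = x\<^sup>2 - (real m + 1) * x + 1"
    using star_quadratic_factor[OF assms, of x] by simp
  then show ?thesis by (simp only:) (simp add: algebra_simps power2_eq_square)
qed

lemma L_Gp_eigenvalue_real:
  assumes n: "n \<ge> 3" and m: "m \<ge> 4" and d: "d \<in> carrier_vec m"
    and w: "0 \<le> d $ 0" "d $ 0 \<le> total_weight d"
    and ev: "eigenvalue (complex_mat (L_Gp n m d)) z"
    and small: "total_weight d < d $ 0 * beta_plus m \<or>
      total_weight d < (min 1 ((beta_plus m - 4) / 4))\<^sup>2"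
  shows "Im z = 0"
proof (rule ccontr)
  assume z: "Im z \<noteq> 0"
  have m2: "m \<ge> 2" "m \<ge> 1" using m by auto
  obtain u v where sys: "network_system n m d z 0 u v" "(\<exists>i<n. u i \<noteq> 0) \<or> (\<exists>j<m. v j \<noteq> 0)"
    using eigenvalue_imp_system[OF n m2(2) d ev] .
  obtain N E where NE: "1 \<le> N" "0 \<le> E" "E \<le> 4 * N"
    "of_real E - z * of_real N = (of_real (total_weight d) - of_real (d $ 0) * z) /
      ((z - of_real (beta_minus m)) * (z - of_real (beta_plus m))) - of_real (total_weight d)"
    by (rule network_response_energy[OF n m2(1) d sys]) (use z in auto)
  \<comment> \<open>Here \<open>m \<ge> 4\<close> enters: the larger star pole exceeds the norm
    bound 4 of the cycle Laplacian.\<close>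
  have "4 < beta_plus m" using beta_facts(3)[OF m2(1)] m by linarith
  then show False
    using response_imp_real[OF beta_facts(1,2)[OF m2(1)] _ w NE small] z by simp
qed

text \<open>For negative \<open>x\<close> both factors of the star quadratic are negative, so the
  response is nonpositive, while \<open>E - x * N\<close> would be positive.\<close>

lemma L_Gp_eigenvalue_nonneg:
  assumes n: "n \<ge> 3" and m: "m \<ge> 2" and d: "d \<in> carrier_vec m"
    and w: "0 \<le> d $ 0" "d $ 0 \<le> total_weight d"
    and ev: "eigenvalue (complex_mat (L_Gp n m d)) (of_real x)"
  shows "0 \<le> x"
proof (rule ccontr)
  assume x: "\<not> 0 \<le> x"
  define a b s t where "a = beta_minus m" "b = beta_plus m" "s = total_weight d" "t = d $ 0"
  note ab = beta_facts[OF m, folded a_b_s_t_def]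
  have m1: "m \<ge> 1" using m by simp
  obtain u v where sys: "network_system n m d (of_real x) 0 u v" "(\<exists>i<n. u i \<noteq> 0) \<or> (\<exists>j<m. v j \<noteq> 0)"
    using eigenvalue_imp_system[OF n m1 d ev] .
  obtain N E where NE: "1 \<le> N" "0 \<le> E" "E \<le> 4 * N"
    and eq: "of_real E - of_real x * of_real N = (of_real s - of_real t * of_real x) /
      ((of_real x - of_real a) * (of_real x - of_real b)) - (of_real s :: complex)"
    unfolding a_b_s_t_def
    by (rule network_response_energy[OF n m d sys]) (use x ab m in \<open>auto simp: a_b_s_t_def\<close>)
  define q where "q = (x - a) * (x - b)"
  have q: "q > 0" unfolding q_def using x ab m by (intro mult_neg_neg) auto
  have "complex_of_real (E - x * N) = of_real ((s - t * x) / q - s)"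
    using eq by (simp add: q_def)
  then have "E - x * N = (s - t * x) / q - s" by (simp only: of_real_eq_iff)
  also have "\<dots> = x * (s * (real m + 1 - x) - t) / q"
    using response_numerator[OF m, of s t x] q by (simp add: a_b_s_t_def q_def field_simps)
  also have "\<dots> \<le> 0"
  proof (intro divide_nonpos_pos mult_nonpos_nonneg)
    have "s * 1 \<le> s * (real m + 1 - x)" using w x by (intro mult_left_mono) (auto simp: a_b_s_t_def)
    then show "0 \<le> s * (real m + 1 - x) - t" using w by (simp add: a_b_s_t_def)
  qed (use x q in auto)
  finally have "E - x * N \<le> 0" .
  moreover have "x * N < 0" using x NE by (intro mult_neg_pos) auto
  ultimately show False using NE by linarith
qed

section \<open>Eigenvalue-free intervals\<close>

lemma alpha_arccos:
  assumes "0 \<le> x" "x \<le> 4"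
  shows "x = 2 - 2 * cos (arccos (1 - x / 2))" "0 \<le> arccos (1 - x / 2)" "arccos (1 - x / 2) \<le> pi"
  using assms by (auto simp: arccos_lbound arccos_ubound)

lemma less_alpha_imp_arccos_less:
  assumes x: "0 \<le> x" "x < alpha n l" and l: "l \<le> n" "0 < n"
  shows "arccos (1 - x / 2) < real l * pi / real n"
proof -
  have y: "0 \<le> real l * pi / real n" "real l * pi / real n \<le> pi"
    using l by (auto simp: field_simps)
  have "2 * (1 - cos (real l * pi / real n)) \<le> 2 * (1 - (- 1))"
    by (intro mult_left_mono diff_left_mono) auto
  then have "alpha n l \<le> 4" by (simp add: alpha_def)
  then have "1 - x / 2 \<le> 1" "-1 \<le> 1 - x / 2" "cos (real l * pi / real n) < 1 - x / 2"
    using x by (auto simp: alpha_def)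
  then have "arccos (1 - x / 2) < arccos (cos (real l * pi / real n))"
    by (intro arccos_less_arccos) auto
  then show ?thesis using y by (simp add: arccos_cos)
qed

lemma cos_recurrence: "cos (y - x) + cos (y + x) = 2 * cos x * cos (y :: real)"
  by (simp add: cos_add cos_diff)

lemma sin_recurrence: "sin (y - x) + sin (y + x) = 2 * cos x * sin (y :: real)"
  by (simp add: sin_add sin_diff)

text \<open>The recurrence and \<open>w 0 = 0\<close> leave only multiples of sin (i \<theta>) / sin
  \<theta>, and the condition at the far end kills the multiple.\<close>

lemma Dirichlet_path_trivial:
  fixes w :: "nat \<Rightarrow> complex"
  assumes w: "w 0 = 0" "w n = 0" and n: "n \<ge> 1" and th: "sin \<theta> \<noteq> 0" "sin (real n * \<theta>) \<noteq> 0"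
    and rec: "\<And>i. i \<in> {1..<n} \<Longrightarrow> w (i - 1) + w (i + 1) = of_real (2 * cos \<theta>) * w i"
    and i: "i \<le> n"
  shows "w i = 0"
proof -
  have sol: "of_real (sin \<theta>) * w i = of_real (sin (real i * \<theta>)) * w 1" if "i \<le> n" for i
    using that
  proof (induction i rule: less_induct)
    case (less i)
    consider "i = 0" | "i = 1" | k where "i = Suc (Suc k)"
      by (metis One_nat_def not0_implies_Suc)
    then show ?case
    proof cases
      case (3 k)
      have "w i = of_real (2 * cos \<theta>) * w (Suc k) - w k"
        using rec[of "Suc k"] less.prems 3 by (simp add: algebra_simps)
      then have "of_real (sin \<theta>) * w i =
          of_real (2 * cos \<theta>) * (of_real (sin \<theta>) * w (Suc k)) - of_real (sin \<theta>) * w k"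
        by (simp only:) (simp add: algebra_simps)
      also have "\<dots> = of_real (2 * cos \<theta> * sin (real (Suc k) * \<theta>) - sin (real k * \<theta>)) * w 1"
        using less.IH[of k] less.IH[of "Suc k"] less.prems 3 by (simp add: algebra_simps)
      also have "2 * cos \<theta> * sin (real (Suc k) * \<theta>) - sin (real k * \<theta>) = sin (real i * \<theta>)"
        using sin_recurrence[of "real (Suc k) * \<theta>" \<theta>] 3 by (simp add: algebra_simps)
      finally show ?thesis .
    qed (use w in auto)
  qed
  have "w 1 = 0" using sol[of n] w th by simp
  then show ?thesis using sol[OF i] th by simp
qed

text \<open>The solution symmetric about the midpoint of the cycle cut at node 0. The symmetry
  closes the cycle, and the recurrence fails at node 0 only, by 2 sin (n \<theta> / 2) sin
  \<theta>.\<close>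

definition cycle_profile :: "nat \<Rightarrow> real \<Rightarrow> nat \<Rightarrow> real" where
  "cycle_profile n \<theta> i = cos ((real n / 2 - real i) * \<theta>)"

lemma cycle_profile_facts:
  assumes "n \<ge> 1"
  shows "cycle_profile n \<theta> n = cycle_profile n \<theta> 0"
    "i \<ge> 1 \<Longrightarrow> cycle_profile n \<theta> (i - 1) + cycle_profile n \<theta> (i + 1) = 2 * cos \<theta> * cycle_profile n \<theta> i"
    "cycle_profile n \<theta> 1 + cycle_profile n \<theta> (n - 1) =
       2 * cos \<theta> * cycle_profile n \<theta> 0 + 2 * sin (real n * \<theta> / 2) * sin \<theta>"
    "cycle_profile n \<theta> 0 = cos (real n * \<theta> / 2)"
proof -
  have "cycle_profile n \<theta> n = cos (- (real n * \<theta> / 2))" by (simp add: cycle_profile_def algebra_simps)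
  then show "cycle_profile n \<theta> n = cycle_profile n \<theta> 0" 
    by (simp add: cycle_profile_def)
  show c0: "cycle_profile n \<theta> 0 = cos (real n * \<theta> / 2)" by (simp add: cycle_profile_def)
  show "cycle_profile n \<theta> (i - 1) + cycle_profile n \<theta> (i + 1) = 2 * cos \<theta> * cycle_profile n \<theta> i" if "i \<ge> 1"
    using cos_recurrence[of "(real n / 2 - real i) * \<theta>" \<theta>] that
    by (simp add: cycle_profile_def of_nat_diff algebra_simps)
  have c1: "cycle_profile n \<theta> 1 = cos (real n * \<theta> / 2 - \<theta>)"
    by (simp add: cycle_profile_def algebra_simps)
  have "cycle_profile n \<theta> (n - 1) = cos (- (real n * \<theta> / 2 - \<theta>))"
    using assms by (simp add: cycle_profile_def of_nat_diff algebra_simps)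
  then have c2: "cycle_profile n \<theta> (n - 1) = cos (real n * \<theta> / 2 - \<theta>)" by (simp only: cos_minus)
  show "cycle_profile n \<theta> 1 + cycle_profile n \<theta> (n - 1) =
       2 * cos \<theta> * cycle_profile n \<theta> 0 + 2 * sin (real n * \<theta> / 2) * sin \<theta>"
    unfolding c1 c2 c0 by (simp add: cos_diff algebra_simps)
qed

text \<open>Below \<open>alpha n 1\<close> the angle satisfies n \<theta> < \<pi>, which forces the
  cycle part to be a multiple of the profile. The row at cycle node 0 would then equate a positive
  quantity with a nonpositive one.\<close>

lemma L_Gp_eigenvalue_gt_beta_minus:
  assumes n: "n \<ge> 3" and m: "m \<ge> 2" and md: "modification m d" and ba: "beta_minus m < alpha n 1"
    and ev: "eigenvalue (complex_mat (L_Gp n m d)) (of_real x)" and x: "0 < x"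
  shows "beta_minus m < x"
proof (rule ccontr)
  assume "\<not> beta_minus m < x"
  then have xb: "x \<le> beta_minus m" by simp
  define a b s t where "a = beta_minus m" "b = beta_plus m" "s = total_weight d" "t = d $ 0"
  note ab = beta_facts[OF m, folded a_b_s_t_def]
  have d: "d \<in> carrier_vec m" using md by (simp add: modification_def)
  have m1: "m \<ge> 1" and n1: "n \<ge> 1" using m n by auto
  note w = modification_weights[OF md m1, folded a_b_s_t_def]
  obtain u v where sys: "network_system n m d (of_real x) 0 u v" and nz: "(\<exists>i<n. u i \<noteq> 0) \<or> (\<exists>j<m. v j \<noteq> 0)"
    using eigenvalue_imp_system[OF n m1 d ev] .
  have x1: "x < 1" using xb ab by (simp add: a_b_s_t_def)
  define \<theta> where "\<theta> = arccos (1 - x / 2)"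
  have th: "x = 2 - 2 * cos \<theta>" "0 \<le> \<theta>" "\<theta> \<le> pi"
    using alpha_arccos[of x] x x1 by (auto simp: \<theta>_def)
  have "\<theta> < real 1 * pi / real n" unfolding \<theta>_def
    by (rule less_alpha_imp_arccos_less) (use x xb ba n in auto)
  then have th_n: "real n * \<theta> < pi" using n by (simp add: field_simps)
  have "\<theta> \<noteq> 0" using th x by auto
  then have th0: "0 < \<theta>" using th by simp
  have "1 * \<theta> \<le> real n * \<theta>" using th0 n by (intro mult_right_mono) auto
  then have thpi: "\<theta> < pi" using th_n by simp
  have pos: "sin \<theta> > 0" "sin (real n * \<theta>) > 0" "sin (real n * \<theta> / 2) > 0" "cos (real n * \<theta> / 2) > 0"
    using th0 th_n thpi n by (auto intro!: sin_gt_zero cos_gt_zero)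
  define c where "c = cycle_profile n \<theta>"
  note prof = cycle_profile_facts[OF n1, where \<theta> = \<theta>, folded c_def]
  have c0: "c 0 > 0" using pos prof(4) by simp
  have u: "u i * of_real (c 0) = u 0 * of_real (c i)" if "i \<le> n" for i
  proof -
    have "u i * of_real (c 0) - u 0 * of_real (c i) = 0"
    proof (rule Dirichlet_path_trivial[where n = n and \<theta> = \<theta> and w = "\<lambda>i. u i * of_real (c 0) - u 0 * of_real (c i)"])
      show "u n * of_real (c 0) - u 0 * of_real (c n) = 0"
        using sys prof(1) by (simp add: network_system_def)
      fix i assume i: "i \<in> {1..<n}"
      have ui: "u (i - 1) + u (i + 1) = of_real (2 * cos \<theta>) * u i"
      proof -
        have "2 * u i - u (i - 1) - u (i + 1) = of_real x * u i"
          using sys i by (auto simp: network_system_def)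
        then show ?thesis unfolding th(1) by (simp add: algebra_simps)
      qed
      have ci: "of_real (c (i - 1)) + of_real (c (i + 1)) = (of_real (2 * cos \<theta>) * of_real (c i) :: complex)"
        using prof(2)[of i] i unfolding of_real_add[symmetric] of_real_mult[symmetric] by simp
      have "u (i - 1) * of_real (c 0) - u 0 * of_real (c (i - 1)) +
           (u (i + 1) * of_real (c 0) - u 0 * of_real (c (i + 1))) =
         (u (i - 1) + u (i + 1)) * of_real (c 0) - u 0 * (of_real (c (i - 1)) + of_real (c (i + 1)))"
        by (simp add: algebra_simps)
      also have "\<dots> = of_real (2 * cos \<theta>) * (u i * of_real (c 0) - u 0 * of_real (c i))"
        unfolding ui ci by (simp add: algebra_simps)
      finally show "u (i - 1) * of_real (c 0) - u 0 * of_real (c (i - 1)) +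
           (u (i + 1) * of_real (c 0) - u 0 * of_real (c (i + 1))) =
           of_real (2 * cos \<theta>) * (u i * of_real (c 0) - u 0 * of_real (c i))" .
    qed (use pos n1 that in auto)
    then show ?thesis by simp
  qed
  define W where "W = (\<Sum>j<m. of_real (d $ j) * v j)"
  have x1': "of_real x \<noteq> (1 :: complex)" using x1 by simp
  note star = star_response[OF m d x1' sys, folded W_def a_b_s_t_def]
  define q where "q = (x - a) * (x - b)"
  \<comment> \<open>\<open>q\<close> vanishes at \<open>x = beta_minus m\<close>, so equations are
    multiplied by \<open>q\<close> and never divided by it.\<close>
  have q: "q \<ge> 0" unfolding q_def using xb ab x1 m by (intro mult_nonpos_nonpos) (auto simp: a_b_s_t_def)
  have qc: "(of_real x - of_real a) * (of_real x - of_real b) = (of_real q :: complex)"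
    by (simp add: q_def)
  have hub: "2 * u 0 - (u 1 + u (n - 1)) + of_real s * u 0 - W = of_real x * u 0"
    using sys unfolding network_system_def W_def a_b_s_t_def by (simp add: algebra_simps)
  have "(u 1 + u (n - 1)) * of_real (c 0) = u 0 * of_real (c 1 + c (n - 1))"
    using u[of 1] u[of "n - 1"] n by (simp add: algebra_simps)
  also have "\<dots> = u 0 * of_real (2 * cos \<theta> * c 0 + 2 * sin (real n * \<theta> / 2) * sin \<theta>)"
    unfolding prof(3) ..
  finally have nb: "(u 1 + u (n - 1)) * of_real (c 0) =
     u 0 * of_real (2 * cos \<theta> * c 0 + 2 * sin (real n * \<theta> / 2) * sin \<theta>)" .
  have "W * of_real (c 0) = (2 * u 0 + of_real s * u 0 - of_real x * u 0) * of_real (c 0)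
      - (u 1 + u (n - 1)) * of_real (c 0)"
    using hub by (simp add: algebra_simps)
  also have "\<dots> = u 0 * of_real (s * c 0 - 2 * sin (real n * \<theta> / 2) * sin \<theta>)"
    unfolding nb th(1) by (simp add: algebra_simps)
  finally have W0: "W * of_real (c 0) = u 0 * of_real (s * c 0 - 2 * sin (real n * \<theta> / 2) * sin \<theta>)" .
  have "(1 - of_real x) * (of_real q * W) = of_real q * ((1 - of_real x) * W)" by simp
  also have "\<dots> = (of_real s - of_real t * of_real x) * (of_real q * v 0)"
    unfolding star(3) by simp
  also have "\<dots> = (1 - of_real x) * ((of_real s - of_real t * of_real x) * u 0)"
    using star(2) unfolding qc by simp
  finally have qW: "of_real q * W = (of_real s - of_real t * of_real x) * u 0" using x1' by simp
  have tx: "t * x < s"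
  proof -
    have "t * x \<le> s * x" using w x by (intro mult_right_mono) auto
    also have "\<dots> < s * 1" using w x1 by (intro mult_strict_left_mono) auto
    finally show ?thesis by simp
  qed
  \<comment> \<open>Otherwise the whole cycle part and \<open>W\<close> vanish, and
    \<open>t * x < s\<close> forces \<open>v 0 = 0\<close>. This works even at
    \<open>beta_minus m\<close>, where the star quadratic gives no information.\<close>
  have u0: "u 0 \<noteq> 0"
  proof
    assume u0: "u 0 = 0"
    then have "u i = 0" if "i \<le> n" for i using u[OF that] c0 by simp
    moreover have "W = 0" using W0 u0 c0 by simp
    have "complex_of_real (s - t * x) * v 0 = 0" using star(3) \<open>W = 0\<close> by simp
    then have "v 0 = 0" using tx by (simp del: of_real_diff of_real_mult)
    then have "v j = 0" if "j < m" for j using star(1)[of j] that by (cases "j = 0") auto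
    ultimately show False using nz by auto
  qed
  have "u 0 * of_real (q * (s * c 0 - 2 * sin (real n * \<theta> / 2) * sin \<theta>)) = of_real q * (W * of_real (c 0))"
    unfolding W0 by simp
  also have "\<dots> = u 0 * of_real ((s - t * x) * c 0)"
    using qW by (simp add: mult.assoc[symmetric])
  finally have "complex_of_real (q * (s * c 0 - 2 * sin (real n * \<theta> / 2) * sin \<theta>)) = of_real ((s - t * x) * c 0)"
    using u0 by simp
  then have "q * (s * c 0 - 2 * sin (real n * \<theta> / 2) * sin \<theta>) = (s - t * x) * c 0"
    by (simp only: of_real_eq_iff)
  then have "(s - t * x - s * q) * c 0 = - (q * (2 * sin (real n * \<theta> / 2) * sin \<theta>))"
    by (simp add: algebra_simps)
  also have "\<dots> \<le> 0" using q pos by simp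
  finally have "s - t * x - s * q \<le> 0" using c0 by (simp add: mult_le_0_iff)
  moreover have "s - t * x - s * q = x * (s * (real m + 1 - x) - t)"
    using response_numerator[OF m] by (simp add: q_def a_b_s_t_def)
  moreover have "s * 1 < s * (real m + 1 - x)" using w x1 m by (intro mult_strict_left_mono) auto
  then have "s * (real m + 1 - x) - t > 0" using w by linarith
  then have "x * (s * (real m + 1 - x) - t) > 0" using x by (intro mult_pos_pos) auto
  ultimately show False by simp
qed

text \<open>Without feedback the cycle equation is homogeneous. A positive \<open>x\<close> below
  \<open>alpha n 2\<close>, the smallest nonzero cycle eigenvalue, makes \<open>u\<close> vanish;
  below \<open>beta_minus m\<close> the star then vanishes too.\<close>

lemma L_G_eigenvalue_ge:
  assumes n: "n \<ge> 3" and m: "m \<ge> 2"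
    and ev: "eigenvalue (complex_mat (L_G n m)) (of_real x)" and x: "0 < x"
  shows "min (alpha n 2) (beta_minus m) \<le> x"
proof (rule ccontr)
  assume "\<not> min (alpha n 2) (beta_minus m) \<le> x"
  then have xlt: "x < alpha n 2" "x < beta_minus m" by auto
  note ab = beta_facts[OF m]
  have m1: "m \<ge> 1" and n1: "n \<ge> 1" using m n by auto
  have d: "0\<^sub>v m \<in> carrier_vec m" by simp
  obtain u v where sys: "network_system n m (0\<^sub>v m) (of_real x) 0 u v" and nz: "(\<exists>i<n. u i \<noteq> 0) \<or> (\<exists>j<m. v j \<noteq> 0)"
    using eigenvalue_imp_system[OF n m1 d ev[unfolded L_G_eq_L_Gp]] .
  have x1: "x < 1" using xlt ab by simp
  define \<theta> where "\<theta> = arccos (1 - x / 2)"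
  have th: "x = 2 - 2 * cos \<theta>" "0 \<le> \<theta>" "\<theta> \<le> pi"
    using alpha_arccos[of x] x x1 by (auto simp: \<theta>_def)
  have "\<theta> < real 2 * pi / real n" unfolding \<theta>_def
    by (rule less_alpha_imp_arccos_less) (use x xlt n in auto)
  then have th_n: "real n * \<theta> < 2 * pi" using n by (simp add: field_simps)
  have "\<theta> \<noteq> 0" using th x by auto
  then have th0: "0 < \<theta>" using th by simp
  (* The recurrence factors over e and cnj e: p i = u (i + 1) - e u i is geometric with ratio cnj e,
     and going once round the cycle forces p = 0 because e ^ n is not 1. *)
  define e where "e = cis \<theta>"
  have e: "cnj e * e = 1" "e + cnj e = of_real (2 * cos \<theta>)"
    by (auto simp: e_def complex_eq_iff cis_mult cis_cnj)
  have "sin (real n * \<theta> / 2) > 0" using th0 th_n n by (intro sin_gt_zero) auto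
  moreover have "cos (real n * \<theta>) = 1 - 2 * (sin (real n * \<theta> / 2))\<^sup>2"
    using cos_double_sin[of "real n * \<theta> / 2"] by simp
  ultimately have "cos (real n * \<theta>) \<noteq> 1" by simp
  then have en: "e ^ n \<noteq> 1" by (auto simp: e_def Complex.DeMoivre complex_eq_iff)
  have rec: "u (i + 1) = (e + cnj e) * u i - u (i - 1)" if "i \<in> {1..<n}" for i
  proof -
    have "2 * u i - u (i - 1) - u (i + 1) = of_real x * u i"
      using sys that by (auto simp: network_system_def)
    then show ?thesis unfolding th(1) e by (simp add: algebra_simps)
  qed
  have un: "u n = u 0" using sys by (simp add: network_system_def)
  have rec0: "u 1 = (e + cnj e) * u 0 - u (n - 1)"
  proof -
    have "2 * u 0 - u 1 - u (n - 1) = of_real x * u 0"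
      using sys by (simp add: network_system_def total_weight_def)
    then show ?thesis unfolding th(1) e by (simp add: algebra_simps)
  qed
  define p where "p i = u (i + 1) - e * u i" for i
  have p: "p i = cnj e ^ i * p 0" if "i < n" for i
    using that
  proof (induction i)
    case (Suc i)
    have "p (Suc i) = cnj e * u (Suc i) - 1 * u i"
      using rec[of "Suc i"] Suc.prems by (simp add: p_def algebra_simps)
    also have "\<dots> = cnj e * u (Suc i) - (cnj e * e) * u i" by (simp only: e(1))
    also have "\<dots> = cnj e * p i" by (simp add: p_def algebra_simps)
    finally show ?case using Suc by simp
  qed simp
  have "p 0 = cnj e * u n - 1 * u (n - 1)"
    using rec0 un by (simp add: p_def algebra_simps)
  also have "\<dots> = cnj e * u n - (cnj e * e) * u (n - 1)" by (simp only: e(1))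
  also have "\<dots> = cnj e * p (n - 1)" using n by (simp add: p_def algebra_simps)
  also have "\<dots> = cnj e ^ n * p 0"
    using p[of "n - 1"] n by (simp add: power_eq_if)
  finally have "p 0 * (1 - cnj e ^ n) = 0" by (simp add: algebra_simps)
  moreover have "cnj e ^ n \<noteq> 1" using en by (metis complex_cnj_cnj complex_cnj_one complex_cnj_power)
  ultimately have "p 0 = 0" by simp
  have u: "u i = e ^ i * u 0" if "i \<le> n" for i
    using that
  proof (induction i)
    case (Suc i)
    then have "p i = 0" using p[of i] \<open>p 0 = 0\<close> by simp
    then show ?case using Suc by (simp add: p_def)
  qed simp
  have "u 0 = 0" using u[of n] un en by simp
  then have "u i = 0" if "i < n" for i using u[of i] that by simp
  moreover have x1': "of_real x \<noteq> (1 :: complex)" using x1 by simp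
  note star = star_response[OF m d x1' sys]
  have "of_real x \<noteq> complex_of_real (beta_minus m)" "of_real x \<noteq> complex_of_real (beta_plus m)"
    using xlt ab m by auto
  then have "v 0 = 0" using star(2) \<open>u 0 = 0\<close> by simp
  then have "v j = 0" if "j < m" for j using star(1)[of j] that by (cases "j = 0") auto
  ultimately show False using nz by auto
qed

section \<open>Explicit eigenvectors\<close>

lemma network_system_ones:
  assumes n: "n \<ge> 3" and m: "m \<ge> 2" and d: "d \<in> carrier_vec m"
  shows "network_system n m d 0 0 (\<lambda>_. 1) (\<lambda>_. 1)"
  using m d by (auto simp: network_system_def total_weight_def of_nat_diff)

lemma L_Gp_eigenvalue_0:
  assumes "n \<ge> 3" "m \<ge> 2" "d \<in> carrier_vec m"
  shows "eigenvalue (complex_mat (L_Gp n m d)) 0"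
  using assms by (intro system_imp_eigenvalue[OF _ _ _ network_system_ones]) auto

text \<open>Without feedback an eigenvector may live on the star alone: \<open>1 - a\<close> at the
  hub and 1 on the leaves.\<close>

lemma L_G_eigenvalue_beta_minus:
  assumes n: "n \<ge> 3" and m: "m \<ge> 2"
  shows "eigenvalue (complex_mat (L_G n m)) (of_real (beta_minus m))"
proof -
  define a where "a = beta_minus m"
  have "a\<^sup>2 - (real m + 1) * a + 1 = 0"
    using star_quadratic_factor[OF m, of a] by (simp add: a_def)
  then have "real m * (1 - a) - (real m - 1) = a * (1 - a)"
    by (simp add: power2_eq_square algebra_simps)
  then have "complex_of_real (real m * (1 - a) - (real m - 1)) = of_real (a * (1 - a))" by (simp only:)
  then have "network_system n m (0\<^sub>v m) (of_real a) 0 (\<lambda>_. 0) (\<lambda>j. if j = 0 then 1 - of_real a else 1)"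
    using m by (simp add: network_system_def of_nat_diff)
  moreover have "a \<noteq> 1" using beta_facts(2)[OF m] by (simp add: a_def)
  then have "1 - of_real a \<noteq> (0 :: complex)"
    by (metis eq_iff_diff_eq_0 of_real_1 of_real_eq_iff)
  ultimately show ?thesis unfolding L_G_eq_L_Gp a_def[symmetric]
    using n m by (intro system_imp_eigenvalue) auto
qed

text \<open>Along the cycle \<open>u\<close> is a quadratic polynomial in the index vanishing at 0
  and \<open>n\<close>, and all star values are multiples of \<open>c\<close>. The row at cycle node
  0 then says that \<open>c\<close> times a positive number is 0.\<close>

lemma network_system_0_trivial:
  assumes n: "n \<ge> 3" and m: "m \<ge> 2" and d: "d \<in> carrier_vec m"
    and w: "0 \<le> d $ 0" "d $ 0 \<le> total_weight d"
    and sys: "network_system n m d 0 c u v" and u0: "u 0 = 0"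
  shows "\<And>i. i \<le> n \<Longrightarrow> u i = 0" "\<And>j. j < m \<Longrightarrow> v j = 0"
proof -
  define s t where "s = total_weight d" "t = d $ 0"
  have un: "u n = 0" using sys u0 by (simp add: network_system_def)
  have ui: "2 * u i = 2 * of_nat i * u 1 - c * of_nat i * (of_nat i - 1)" if "i \<le> n" for i
    using that
  proof (induction i rule: less_induct)
    case (less i)
    consider "i = 0" | "i = 1" | k where "i = Suc (Suc k)"
      by (metis One_nat_def not0_implies_Suc)
    then show ?case
    proof cases
      case (3 k)
      have "2 * u (Suc k) - u k - u (Suc (Suc k)) = c"
        using sys less.prems 3 unfolding network_system_def by force
      then have "2 * u i = 2 * (2 * u (Suc k)) - 2 * u k - 2 * c" using 3 by (simp add: algebra_simps)
      also have "\<dots> = 2 * of_nat i * u 1 - c * of_nat i * (of_nat i - 1)"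
        using less.IH[of k] less.IH[of "Suc k"] less.prems 3 by (simp only:) (simp add: algebra_simps)
      finally show ?thesis .
    qed (use u0 in auto)
  qed
  have "of_nat n * (2 * u 1 - c * (of_nat n - 1)) = 0"
    using ui[of n] un by (simp add: algebra_simps)
  then have u1: "2 * u 1 = c * (of_nat n - 1)" using n by simp
  have un1: "2 * u (n - 1) = c * (of_nat n - 1)"
  proof -
    have "2 * u (n - 1) = (of_nat n - 1) * (2 * u 1) - c * (of_nat n - 1) * (of_nat n - 2)"
      using ui[of "n - 1"] n by (simp add: of_nat_diff algebra_simps)
    then show ?thesis unfolding u1 by (simp add: algebra_simps)
  qed
  have leaf: "v j = v 0 + c" if "j \<in> {1..<m}" for j
    using sys that by (auto simp: network_system_def algebra_simps)
  have "(\<Sum>j\<in>{1..<m}. v j) = (of_nat m - 1) * (v 0 + c)"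
    using leaf m by (simp add: of_nat_diff)
  moreover have "of_nat m * v 0 - (\<Sum>j\<in>{1..<m}. v j) = c"
    using sys u0 by (simp add: network_system_def)
  ultimately have v0: "v 0 = of_nat m * c" by (simp add: algebra_simps)
  have split: "{..<m} = insert 0 {1..<m}" using m by auto
  define W where "W = (\<Sum>j<m. of_real (d $ j) * v j)"
  have W1: "W = of_real t * v 0 + of_real (s - t) * (v 0 + c)"
    using m leaf unfolding split s_t_def W_def
    by (simp add: total_weight_split[OF d] sum_distrib_right)
  have W2: "- u 1 - u (n - 1) - W = c"
    using sys u0 by (simp add: network_system_def W_def)
  have "2 * c + 2 * u 1 + 2 * u (n - 1) + 2 * W = 0"
    unfolding W2[symmetric] by (simp add: algebra_simps)
  then have "2 * (c * of_real (real n + t * real m + (s - t) * (real m + 1))) = 0"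
    unfolding u1 un1 W1 v0 by (simp add: algebra_simps)
  then have "c * of_real (real n + t * real m + (s - t) * (real m + 1)) = 0" by simp
  moreover have "real n + t * real m + (s - t) * (real m + 1) > 0"
    using n w by (intro add_pos_nonneg mult_nonneg_nonneg) (auto simp: s_t_def)
  ultimately have c: "c = 0" by (metis less_irrefl mult_eq_0_iff of_real_eq_0_iff)
  show "u i = 0" if "i \<le> n" for i using ui[OF that] u1 c by simp
  show "v j = 0" if "j < m" for j using leaf[of j] v0 c that by (cases "j = 0") auto
qed

lemma char_poly_L_Gp_zero_simple:
  assumes n: "n \<ge> 3" and m: "m \<ge> 2" and d: "d \<in> carrier_vec m"
    and w: "0 \<le> d $ 0" "d $ 0 \<le> total_weight d"
  shows "\<exists>p. char_poly (complex_mat (L_Gp n m d)) = [:0, 1:] * p \<and> poly p 0 \<noteq> 0"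
proof (rule char_poly_zero_row_sums)
  have m1: "m \<ge> 1" using m by simp
  show "complex_mat (L_Gp n m d) \<in> carrier_mat (n + m) (n + m)" using d by simp
  show "0 < n + m" using n by simp
  have "network_system n m d 0 0 (\<lambda>i. vec (n + m) (\<lambda>_. 1) $ (i mod n)) (\<lambda>j. vec (n + m) (\<lambda>_. 1) $ (n + j))"
    using network_system_ones[OF n m d] n by (subst network_system_cong[OF n m1]) (auto simp: trans_less_add1)
  then have "complex_mat (L_Gp n m d) *\<^sub>v vec (n + m) (\<lambda>_. 1)
     = vec (n + m) (\<lambda>i. 0 * vec (n + m) (\<lambda>_. 1) $ i + 0)"
    using L_Gp_mult_vec_iff_system[OF n m1 d, of "vec (n + m) (\<lambda>_. 1)" 0 0] by simp
  then show "complex_mat (L_Gp n m d) *\<^sub>v vec (n + m) (\<lambda>_. 1) = 0\<^sub>v (n + m)" by (auto simp: zero_vec_def)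
  fix w :: "complex vec" and c
  assume wc: "w \<in> carrier_vec (n + m)" "w $ 0 = 0"
    "complex_mat (L_Gp n m d) *\<^sub>v w = vec (n + m) (\<lambda>_. c)"
  then have "network_system n m d 0 c (\<lambda>i. w $ (i mod n)) (\<lambda>j. w $ (n + j))"
    using L_Gp_mult_vec_iff_system[OF n m1 d wc(1), of 0 c] by simp
  note triv = network_system_0_trivial[OF n m d assms(4,5) this]
  show "w = 0\<^sub>v (n + m)"
  proof (rule eq_vecI)
    fix i assume "i < dim_vec (0\<^sub>v (n + m) :: complex vec)"
    then have "i < n + m" by simp
    then show "w $ i = 0\<^sub>v (n + m) $ i"
      using triv(1)[of i] triv(2)[of "i - n"] wc(2) by (cases "i < n") auto
  qed (use wc in auto)
qed

text \<open>An intermediate value argument finds a root of the secular function \<open>F\<close>,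
  and the profile at that angle extends to an explicit eigenvector.\<close>

lemma L_Gp_small_eigenvalue:
  assumes n: "n \<ge> 3" and m: "m \<ge> 2" and md: "modification m d" and ab1: "alpha n 1 < beta_minus m"
  obtains x where "0 < x" "x < min (alpha n 2) (beta_minus m)"
    "eigenvalue (complex_mat (L_Gp n m d)) (of_real x)"
proof -
  define a b s t where "a = beta_minus m" "b = beta_plus m" "s = total_weight d" "t = d $ 0"
  note ab = beta_facts[OF m, folded a_b_s_t_def]
  have d: "d \<in> carrier_vec m" using md by (simp add: modification_def)
  have m1: "m \<ge> 1" and n1: "n \<ge> 1" using m n by auto
  note w = modification_weights[OF md m1, folded a_b_s_t_def]
  define q where "q x = (x - a) * (x - b)" for x :: real
  define \<chi> where "\<chi> \<theta> = 2 - 2 * cos \<theta>" for \<theta> :: real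
  define g where "g x = x * (s * (real m + 1 - x) - t)" for x
  \<comment> \<open>At \<open>\<theta>0\<close> the cosine term drops out. At
    \<open>\<theta>1\<close> the sine term does, through \<open>q\<close> or through the sine
    itself, according to which value attains the minimum \<open>y\<close>.\<close>
  define F where "F \<theta> = 2 * q (\<chi> \<theta>) * sin (real n * \<theta> / 2) * sin \<theta> + g (\<chi> \<theta>) * cos (real n * \<theta> / 2)" for \<theta>
  define y where "y = min (alpha n 2) a"
  define \<theta>0 where "\<theta>0 = pi / real n"
  define \<theta>1 where "\<theta>1 = arccos (1 - y / 2)"
  have \<theta>0: "0 < \<theta>0" "2 * \<theta>0 < pi" using n by (auto simp: \<theta>0_def field_simps)
  have a0: "\<chi> \<theta>0 = alpha n 1" and a2: "alpha n 2 = \<chi> (2 * \<theta>0)"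
    by (auto simp: \<chi>_def alpha_def \<theta>0_def)
  have mono: "\<chi> p < \<chi> r" if "0 \<le> p" "p < r" "r \<le> pi" for p r
    using cos_monotone_0_pi[of p r] that by (simp add: \<chi>_def)
  have pos0: "0 < \<chi> \<theta>0" using mono[of 0 \<theta>0] \<theta>0 by (simp add: \<chi>_def)
  have y0: "\<chi> \<theta>0 < y" using mono[of \<theta>0 "2 * \<theta>0"] \<theta>0 ab1 by (simp add: y_def a2 a0 a_b_s_t_def)
  have y1: "0 < y" "y < 1" using y0 pos0 ab by (auto simp: y_def)
  have \<theta>1: "\<chi> \<theta>1 = y" "0 \<le> \<theta>1" "\<theta>1 \<le> pi"
    using alpha_arccos[of y] y1 by (auto simp: \<chi>_def \<theta>1_def)
  have "\<not> \<theta>1 \<le> \<theta>0" using mono[of \<theta>1 \<theta>0] \<theta>1 y0 \<theta>0 by (auto simp: le_less)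
  then have \<theta>01: "\<theta>0 < \<theta>1" by simp
  have \<theta>12: "\<theta>1 \<le> 2 * \<theta>0"
    using mono[of "2 * \<theta>0" \<theta>1] \<theta>1 \<theta>0 by (force simp: y_def a2 not_less[symmetric])
  have halfn: "real n * \<theta>0 / 2 = pi / 2" using n by (simp add: \<theta>0_def)
  have cosneg: "cos (real n * \<theta> / 2) < 0" if "\<theta>0 < \<theta>" "\<theta> \<le> \<theta>1" for \<theta>
  proof -
    have "real n * \<theta>0 < real n * \<theta>" "real n * \<theta> \<le> real n * (2 * \<theta>0)"
      using that \<theta>12 n by (auto intro!: mult_strict_left_mono mult_left_mono)
    then have "pi / 2 < real n * \<theta> / 2" "real n * \<theta> / 2 \<le> pi" using halfn by auto
    then show ?thesis using cos_monotone_0_pi[of "pi / 2" "real n * \<theta> / 2"] by simp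
  qed
  have F0: "F \<theta>0 > 0"
  proof -
    have "q (\<chi> \<theta>0) > 0" unfolding q_def
      using y0 ab m by (intro mult_neg_neg) (auto simp: y_def)
    moreover have "sin \<theta>0 > 0" using \<theta>0 by (intro sin_gt_zero) auto
    ultimately show ?thesis by (simp add: F_def halfn)
  qed
  have F1: "F \<theta>1 < 0"
  proof -
    have "q (\<chi> \<theta>1) * sin (real n * \<theta>1 / 2) = 0"
    proof (cases "y = a")
      case False
      then have "\<chi> \<theta>1 = \<chi> (2 * \<theta>0)" using \<theta>1 by (simp add: y_def a2 min_def split: if_splits)
      then have "\<theta>1 = 2 * \<theta>0" using mono[of \<theta>1 "2 * \<theta>0"] \<theta>12 \<theta>1 \<theta>0 by force
      then show ?thesis using halfn by simp
    qed (simp add: \<theta>1 q_def)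
    moreover have "g y > 0"
    proof -
      have "s * 1 < s * (real m + 1 - y)" using w y1 m by (intro mult_strict_left_mono) auto
      then have "s * (real m + 1 - y) - t > 0" using w by linarith
      then show ?thesis unfolding g_def using y1 by (intro mult_pos_pos) auto
    qed
    then have "g y * cos (real n * \<theta>1 / 2) < 0" using cosneg[of \<theta>1] \<theta>01 by (intro mult_pos_neg) auto
    ultimately show ?thesis by (auto simp: F_def \<theta>1)
  qed
  have "continuous_on {\<theta>0..\<theta>1} F"
    unfolding F_def g_def q_def \<chi>_def by (intro continuous_intros) auto
  then obtain \<theta> where th: "\<theta>0 \<le> \<theta>" "\<theta> \<le> \<theta>1" "F \<theta> = 0"
    using IVT2'[of F \<theta>1 0 \<theta>0] F0 F1 \<theta>01 by auto
  \<comment> \<open>\<open>F\<close> is nonzero at both ends, so the root is interior. Hence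
    \<open>x < a\<close>, which makes \<open>Q\<close> positive and permits division by it.\<close>
  then have th': "\<theta>0 < \<theta>" "\<theta> < \<theta>1" using F0 F1 by (auto simp: order.order_iff_strict)
  define x where "x = \<chi> \<theta>"
  have x: "0 < x" "x < y" using mono[of \<theta>0 \<theta>] mono[of \<theta> \<theta>1] th' \<theta>1 \<theta>0 pos0 by (auto simp: x_def)
  have x1: "x < 1" using x y1 by simp
  define Q where "Q = q x"
  have Q: "Q > 0" unfolding Q_def q_def
    using x ab m by (intro mult_neg_neg) (auto simp: y_def)
  define c where "c = cycle_profile n \<theta>"
  note prof = cycle_profile_facts[OF n1, where \<theta> = \<theta>, folded c_def]
  have c0: "c 0 < 0" using cosneg[OF th'(1) th(2)] prof(4) by simp
  \<comment> \<open>The star values are dictated by \<open>star_response\<close> for the cycle value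
    \<open>c 0\<close>.\<close>
  define v where "v j = (if j = 0 then (1 - x) * c 0 / Q else c 0 / Q)" for j :: nat
  have split: "{..<m} = insert 0 {1..<m}" using m by auto
  have W: "(\<Sum>j<m. d $ j * v j) = (s - t * x) * c 0 / Q"
  proof -
    have "(\<Sum>j<m. d $ j * v j) = t * ((1 - x) * c 0 / Q) + (\<Sum>j\<in>{1..<m}. d $ j) * (c 0 / Q)"
      unfolding split sum_distrib_right by (simp add: v_def a_b_s_t_def)
    also have "(\<Sum>j\<in>{1..<m}. d $ j) = s - t"
      by (simp add: total_weight_split[OF d m1] a_b_s_t_def)
    also have "t * ((1 - x) * c 0 / Q) + (s - t) * (c 0 / Q) = (s - t * x) * c 0 / Q"
      using Q by (simp add: field_simps)
    finally show ?thesis .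
  qed
  have eq0: "2 * c 0 - c 1 - c (n - 1) + s * c 0 - (\<Sum>j<m. d $ j * v j) = x * c 0"
  proof -
    have "g x = s - t * x - s * Q"
      using response_numerator[OF m, of s t x] by (simp add: g_def Q_def q_def a_b_s_t_def)
    then have "2 * Q * sin (real n * \<theta> / 2) * sin \<theta> + (s - t * x - s * Q) * c 0 = 0"
      using th(3) by (simp add: F_def x_def[symmetric] Q_def prof(4))
    then have "(s - t * x) * c 0 / Q = s * c 0 - 2 * sin (real n * \<theta> / 2) * sin \<theta>"
      using Q by (simp add: field_simps)
    moreover have "2 * c 0 - (c 1 + c (n - 1)) = x * c 0 - 2 * sin (real n * \<theta> / 2) * sin \<theta>"
      unfolding prof(3) by (simp add: x_def \<chi>_def algebra_simps)
    ultimately show ?thesis unfolding W by simp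
  qed
  have eqi: "2 * c i - c (i - 1) - c (i + 1) = x * c i" if "i \<in> {1..<n}" for i
    using prof(2)[of i] that by (simp add: x_def \<chi>_def algebra_simps)
  have eqhub: "real m * v 0 - (\<Sum>j\<in>{1..<m}. v j) - c 0 = x * v 0"
  proof -
    have leaves: "(\<Sum>j\<in>{1..<m}. v j) = (real m - 1) * (c 0 / Q)" using m by (simp add: v_def of_nat_diff)
    have "Q = x\<^sup>2 - (real m + 1) * x + 1"
      using star_quadratic_factor[OF m, of x] by (simp add: Q_def q_def a_b_s_t_def)
    then have hub: "(real m * (1 - x) - (real m - 1) - Q) * c 0 = x * (1 - x) * c 0"
      by (simp only:) (simp add: power2_eq_square algebra_simps)
    have "real m * v 0 - (\<Sum>j\<in>{1..<m}. v j) - c 0 = (real m * (1 - x) - (real m - 1) - Q) * c 0 / Q"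
      unfolding leaves using Q by (simp add: v_def field_simps)
    also have "\<dots> = x * v 0" unfolding hub by (simp add: v_def)
    finally show ?thesis .
  qed
  have eqleaf: "v j - v 0 = x * v j" if "j \<in> {1..<m}" for j
    using that Q by (auto simp: v_def field_simps)
  have "network_system n m d (of_real x) 0 (\<lambda>i. of_real (c i)) (\<lambda>j. of_real (v j))"
    unfolding network_system_def add_0_right
  proof (intro conjI ballI)
    show "complex_of_real (c n) = of_real (c 0)" by (simp add: prof(1))
    show "2 * complex_of_real (c 0) - of_real (c 1) - of_real (c (n - 1)) + of_real (total_weight d) * of_real (c 0)
        - (\<Sum>j<m. of_real (d $ j) * of_real (v j)) = of_real x * of_real (c 0)"
      using arg_cong[OF eq0, of complex_of_real] by (simp add: a_b_s_t_def)
    show "2 * complex_of_real (c i) - of_real (c (i - 1)) - of_real (c (i + 1)) = of_real x * of_real (c i)"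
      if "i \<in> {1..<n}" for i
      using arg_cong[OF eqi[OF that], of complex_of_real] by simp
    show "of_nat m * complex_of_real (v 0) - (\<Sum>j\<in>{1..<m}. of_real (v j)) - of_real (c 0) = of_real x * of_real (v 0)"
      using arg_cong[OF eqhub, of complex_of_real] by simp
    show "complex_of_real (v j) - of_real (v 0) = of_real x * of_real (v j)" if "j \<in> {1..<m}" for j
      using arg_cong[OF eqleaf[OF that], of complex_of_real] by simp
  qed
  moreover have "complex_of_real (v 0) \<noteq> 0" using c0 x1 Q by (simp add: v_def)
  ultimately have "eigenvalue (complex_mat (L_Gp n m d)) (of_real x)"
    by (intro system_imp_eigenvalue[OF n m1 d])
  then show ?thesis using that x by (simp add: y_def a_b_s_t_def)
qed

section \<open>The second eigenvalue\<close>

lemma eigenvalue_listing_set: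
  assumes L: "L \<in> carrier_mat k k" and zs: "eigenvalue_listing L zs"
  shows "eigenvalue (complex_mat L) z \<longleftrightarrow> z \<in> set zs"
proof -
  have "poly (\<Prod>z\<leftarrow>xs. [:- z, 1:]) z = 0 \<longleftrightarrow> z \<in> set xs" for xs :: "complex list"
    by (induction xs) auto
  then show ?thesis
    using eigenvalue_root_char_poly[of "complex_mat L" k] L zs by (simp add: eigenvalue_listing_def)
qed

text \<open>Distinct eigenvalues occupy two positions of the sorted listing, and the later one has
  index at least 1.\<close>

lemma Re_lambda2_le:
  assumes L: "L \<in> carrier_mat k k"
    and ev: "eigenvalue (complex_mat L) z" "eigenvalue (complex_mat L) w" "z \<noteq> w"
    and r: "Re z \<le> r" "Re w \<le> r"
  shows "Re (lambda2 L) \<le> r"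
proof -
  obtain zs where zs: "eigenvalue_listing L zs" using eigenvalue_listing_exists[OF L] by blast
  have "z \<in> set zs" "w \<in> set zs" using ev eigenvalue_listing_set[OF L zs] by auto
  then obtain i j where ij: "i < length zs" "j < length zs" "zs ! i = z" "zs ! j = w"
    by (auto simp: in_set_conv_nth)
  have "i \<noteq> j" using ij ev(3) by auto
  define l where "l = max i j"
  have l: "1 \<le> l" "l < length zs" "Re (zs ! l) \<le> r"
    using ij \<open>i \<noteq> j\<close> r by (auto simp: l_def max_def)
  have "map Re zs ! 1 \<le> map Re zs ! l"
    using zs l unfolding eigenvalue_listing_def by (intro sorted_nth_mono) auto
  then show ?thesis using Re_lambda2_eq[OF zs] l by simp
qed

text \<open>If the second entry had real part at most \<open>r\<close>, so would the first; both
  would be 0, making 0 a double root.\<close>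

lemma less_Re_lambda2:
  assumes L: "L \<in> carrier_mat k k" and k: "2 \<le> k"
    and simple: "\<exists>p. char_poly (complex_mat L) = [:0, 1:] * p \<and> poly p 0 \<noteq> 0"
    and r: "\<And>z. eigenvalue (complex_mat L) z \<Longrightarrow> z \<noteq> 0 \<Longrightarrow> r < Re z"
  shows "r < Re (lambda2 L)"
proof (rule ccontr)
  assume neg: "\<not> r < Re (lambda2 L)"
  obtain zs where zs: "eigenvalue_listing L zs" using eigenvalue_listing_exists[OF L] by blast
  obtain p where p: "char_poly (complex_mat L) = [:0, 1:] * p" "poly p 0 \<noteq> 0" using simple by blast
  have cp: "char_poly (complex_mat L) = (\<Prod>z\<leftarrow>zs. [:- z, 1:])"
    using zs by (simp add: eigenvalue_listing_def)
  have "length zs = k"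
    using degree_monic_char_poly[of "complex_mat L" k] L degree_linear_factors[of uminus zs] cp by simp
  then obtain x y xs where xs: "zs = x # y # xs"
    using k by (cases zs; cases "tl zs") auto
  have "Re y = Re (lambda2 L)" using Re_lambda2_eq[OF zs] xs by simp
  moreover have "Re x \<le> Re y" using zs xs by (simp add: eigenvalue_listing_def)
  ultimately have "\<not> r < Re x" "\<not> r < Re y" using neg by auto
  then have "x = 0" "y = 0" using r eigenvalue_listing_set[OF L zs] xs by auto
  then have "[:0, 1:] * p = [:0, 1:] * ([:0, 1:] * (\<Prod>z\<leftarrow>xs. [:- z, 1:]))"
    using p(1) cp xs by simp
  then have "p = [:0, 1:] * (\<Prod>z\<leftarrow>xs. [:- z, 1:])" by (subst (asm) mult_left_cancel) auto
  then show False using p(2) by simp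
qed

section \<open>Comparison of the two spectral gaps\<close>

lemma Re_lambda2_L_G_gt:
  assumes n: "n \<ge> 3" and m: "m \<ge> 4" and r: "r < min (alpha n 2) (beta_minus m)"
  shows "r < Re (lambda2 (L_G n m))"
proof -
  have m2: "m \<ge> 2" using m by simp
  have d: "0\<^sub>v m \<in> carrier_vec m" by simp
  have w: "0 \<le> (0\<^sub>v m :: real vec) $ 0" "0\<^sub>v m $ 0 \<le> total_weight (0\<^sub>v m)" "total_weight (0\<^sub>v m) = 0"
    using m by (auto simp: total_weight_def)
  show ?thesis
  proof (rule less_Re_lambda2)
    show "L_G n m \<in> carrier_mat (n + m) (n + m)" "2 \<le> n + m" using n by (auto simp: L_G_eq_L_Gp)
    show "\<exists>p. char_poly (complex_mat (L_G n m)) = [:0, 1:] * p \<and> poly p 0 \<noteq> 0"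
      unfolding L_G_eq_L_Gp by (rule char_poly_L_Gp_zero_simple[OF n m2 d w(1,2)])
    fix z assume z: "eigenvalue (complex_mat (L_G n m)) z" "z \<noteq> 0"
    have "4 < beta_plus m" using beta_facts(3)[OF m2] m by linarith
    then have "0 < (min 1 ((beta_plus m - 4) / 4))\<^sup>2" by (intro zero_less_power) simp
    \<comment> \<open>Zero total weight meets the smallness condition, so the unmodified spectrum is
      real.\<close>
    then have "Im z = 0"
      using L_Gp_eigenvalue_real[OF n m d w(1,2) z(1)[unfolded L_G_eq_L_Gp]] w(3) by simp
    then have zx: "z = of_real (Re z)" by (simp add: complex_eq_iff)
    then have "0 \<le> Re z"
      using L_Gp_eigenvalue_nonneg[OF n m2 d w(1,2)] z(1) unfolding L_G_eq_L_Gp by metis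
    moreover have "Re z \<noteq> 0" using z(2) zx by auto
    ultimately have "min (alpha n 2) (beta_minus m) \<le> Re z"
      using L_G_eigenvalue_ge[OF n m2] z(1) zx by (metis less_le)
    then show "r < Re z" using r by linarith
  qed
qed

text \<open>A real eigenvalue besides 0 bounds the gap from above whether or not the rest of the
  spectrum is real, so this covers weights of any size.\<close>

lemma Re_lambda2_L_Gp_less:
  assumes n: "n \<ge> 3" and m: "m \<ge> 4" and md: "modification m d" and a: "alpha n 1 < beta_minus m"
  shows "Re (lambda2 (L_Gp n m d)) < Re (lambda2 (L_G n m))"
proof -
  have m2: "m \<ge> 2" using m by simp
  have d: "d \<in> carrier_vec m" using md by (simp add: modification_def)
  obtain x where x: "0 < x" "x < min (alpha n 2) (beta_minus m)"
    "eigenvalue (complex_mat (L_Gp n m d)) (of_real x)"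
    using L_Gp_small_eigenvalue[OF n m2 md a] .
  have "Re (lambda2 (L_Gp n m d)) \<le> x"
    by (rule Re_lambda2_le[OF L_Gp_carrier[OF d] L_Gp_eigenvalue_0[OF n m2 d] x(3)]) (use x in auto)
  also have "x < Re (lambda2 (L_G n m))" by (rule Re_lambda2_L_G_gt[OF n m x(2)])
  finally show ?thesis .
qed

text \<open>\<open>beta_minus m\<close> separates the two gaps. Reality turns the bound for real
  eigenvalues into one for the whole spectrum.\<close>

lemma Re_lambda2_L_Gp_greater:
  assumes n: "n \<ge> 3" and m: "m \<ge> 2" and md: "modification m d" and b: "beta_minus m < alpha n 1"
    and real: "all_eigenvalues_real (L_Gp n m d)"
  shows "Re (lambda2 (L_G n m)) < Re (lambda2 (L_Gp n m d))"
proof -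
  have m1: "m \<ge> 1" using m by simp
  have d: "d \<in> carrier_vec m" using md by (simp add: modification_def)
  note w = modification_weights[OF md m1]
  note ab = beta_facts[OF m]
  have "Re (lambda2 (L_G n m)) \<le> beta_minus m"
  proof (rule Re_lambda2_le)
    show "L_G n m \<in> carrier_mat (n + m) (n + m)" by (simp add: L_G_eq_L_Gp)
    show "eigenvalue (complex_mat (L_G n m)) 0"
      unfolding L_G_eq_L_Gp using n m by (intro L_Gp_eigenvalue_0) auto
    show "eigenvalue (complex_mat (L_G n m)) (of_real (beta_minus m))"
      by (rule L_G_eigenvalue_beta_minus[OF n m])
  qed (use ab in auto)
  also have "beta_minus m < Re (lambda2 (L_Gp n m d))"
  proof (rule less_Re_lambda2[OF L_Gp_carrier[OF d] _ char_poly_L_Gp_zero_simple[OF n m d w(2,3)]])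
    fix z assume z: "eigenvalue (complex_mat (L_Gp n m d)) z" "z \<noteq> 0"
    then have zx: "z = of_real (Re z)"
      using real by (auto simp: all_eigenvalues_real_def complex_is_Real_iff complex_eq_iff)
    then have "0 \<le> Re z" using L_Gp_eigenvalue_nonneg[OF n m d w(2,3)] z(1) by metis
    moreover have "Re z \<noteq> 0" using z(2) zx by auto
    ultimately show "beta_minus m < Re z"
      using L_Gp_eigenvalue_gt_beta_minus[OF n m md b] z(1) zx by (metis less_le)
  qed (use n in simp)
  finally show ?thesis .
qed

lemma alpha_1_less_alpha_2:
  assumes "n \<ge> 3"
  shows "alpha n 1 < alpha n 2"
  using cos_monotone_0_pi[of "pi / real n" "2 * pi / real n"] assms
  by (simp add: alpha_def field_simps)

theorem theoremB:
  fixes n m :: nat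
  assumes n: "n \<ge> 3" and m: "m \<ge> 4"
    and generic: "beta_minus m \<notin> {alpha n l | l. l < n}"
  shows
    "(\<exists>\<epsilon>>0. \<forall>d. modification m d \<and> total_weight d < \<epsilon> \<longrightarrow>
       all_eigenvalues_real (L_Gp n m d) \<and>
       (alpha n 1 < beta_minus m \<longrightarrow> Re (lambda2 (L_Gp n m d)) < Re (lambda2 (L_G n m))) \<and>
       (beta_minus m < alpha n 1 \<longrightarrow> Re (lambda2 (L_Gp n m d)) > Re (lambda2 (L_G n m)))) \<and>
     (\<forall>d. modification m d \<longrightarrow>
       (alpha n 2 < beta_minus m \<longrightarrow> Re (lambda2 (L_Gp n m d)) < Re (lambda2 (L_G n m))) \<and>
       (total_weight d < d $ 0 * beta_plus m \<longrightarrow>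
          all_eigenvalues_real (L_Gp n m d) \<and>
          (alpha n 1 < beta_minus m \<longrightarrow> Re (lambda2 (L_Gp n m d)) < Re (lambda2 (L_G n m))) \<and>
          (beta_minus m < alpha n 1 \<longrightarrow> Re (lambda2 (L_Gp n m d)) > Re (lambda2 (L_G n m)))))"
proof -
  have m': "m \<ge> 2" "m \<ge> 1" using m by auto
  \<comment> \<open>The threshold of \<open>L_Gp_eigenvalue_real\<close>; it depends on
    \<open>m\<close> only.\<close>
  define \<epsilon> where "\<epsilon> = (min 1 ((beta_plus m - 4) / 4))\<^sup>2"
  have "4 < beta_plus m" using beta_facts(3)[OF m'(1)] m by linarith
  then have "\<epsilon> > 0" unfolding \<epsilon>_def by (intro zero_less_power) simp
  have real: "all_eigenvalues_real (L_Gp n m d)"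
    if "modification m d" "total_weight d < d $ 0 * beta_plus m \<or> total_weight d < \<epsilon>" for d
    unfolding all_eigenvalues_real_def complex_is_Real_iff
    using L_Gp_eigenvalue_real[OF n m _ modification_weights(2,3)[OF that(1) m'(2)]] that
    by (auto simp: \<epsilon>_def modification_def)
  note less = Re_lambda2_L_Gp_less[OF n m]
  note greater = Re_lambda2_L_Gp_greater[OF n m'(1) _ _ real]
  show ?thesis
  proof (intro conjI exI[of _ \<epsilon>] allI impI; (elim conjE)?)
    show "0 < \<epsilon>" by fact
  next
    \<comment> \<open>As \<open>alpha n 1 < alpha n 2\<close>, this case falls under the comparison
      valid for weights of any size.\<close>
    fix d assume "modification m d" "alpha n 2 < beta_minus m"
    then show "Re (lambda2 (L_Gp n m d)) < Re (lambda2 (L_G n m))"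
      using less alpha_1_less_alpha_2[OF n] by simp
  qed (use real less greater in blast)+
qed

end
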